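(* Let $N$ be a positive integer. Then the eta product $$S_N(\tau) := \frac{\eta(N\tau)^{\phi(N)}}{\prod_{d\mid N}\eta(d\tau)^{\mu(d)}}$$ has nonnegative Fourier coefficients; that is, all coefficients in its expansion in (possibly fractional) powers of $q=\exp(2\pi i\tau)$ are nonnegative.
   Context: Here $\Im\tau>0$, $q=\exp(2\pi i\tau)$, and $q^{s}$ means $\exp(2\pi i s\tau)$ for rational $s$. The Dedekind eta function is $\eta(\tau)=q^{1/24}\prod_{n=1}^\infty(1-q^n)$. $\phi$ is Euler's totient function and $\mu$ is the Möbius function; the product is over the positive divisors $d$ of $N$. Each $S_N(\tau)$ equals a power $q^{s}$ ($s$ rational) times a power series in $q$ with integer coefficients; these coefficients are the Fourier coefficients of $S_N$. *)

theory Defs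
  imports "HOL-Analysis.Infinite_Products" "HOL-Analysis.Complex_Transcendental"
    "HOL-Number_Theory.Totient" "HOL-Computational_Algebra.Squarefree"
begin

definition q_pow :: "rat \<Rightarrow> complex \<Rightarrow> complex" where
  "q_pow s \<tau> = exp (2 * of_real pi * \<i> * of_rat s * \<tau>)"

definition dedekind_eta :: "complex \<Rightarrow> complex" where
  "dedekind_eta \<tau> = q_pow (1 / 24) \<tau> * (\<Prod>n. 1 - q_pow 1 \<tau> ^ Suc n)"

definition moebius_mu :: "nat \<Rightarrow> int" where
  "moebius_mu n = (if squarefree n then (-1) ^ card (prime_factors n) else 0)"

definition eta_S :: "nat \<Rightarrow> complex \<Rightarrow> complex" where
  "eta_S N \<tau> = dedekind_eta (of_nat N * \<tau>) ^ totient N /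
     (\<Prod>d | d dvd N. dedekind_eta (of_nat d * \<tau>) powi moebius_mu d)"

text \<open>
  The pair \<open>(s, a)\<close> is determined by a nonzero \<open>f\<close> only
  up to zero padding: replacing \<open>s\<close> by \<open>s - 1\<close> shifts \<open>a\<close> by one place.
\<close>
definition has_q_expansion :: "(complex \<Rightarrow> complex) \<Rightarrow> rat \<Rightarrow> (nat \<Rightarrow> int) \<Rightarrow> bool" where
  "has_q_expansion f s a \<longleftrightarrow>
     (\<forall>\<tau>. Im \<tau> > 0 \<longrightarrow> (\<lambda>n. of_int (a n) * q_pow (s + of_nat n) \<tau>) sums f \<tau>)"

end

theory Submission
  imports Defs
begin

text \<open>
  Write \<open>E(q) = \<Prod>(1 - q^n)\<close> and \<open>[z;Q] = \<Prod>(1 - z Q^n)(1 - Q^(n+1)/z)\<close>. Up to a power of \<open>q\<close>,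
  \<open>S_N = E(q^N)^\<phi>(N) / \<Prod>(1 - q^m)\<close> over the \<open>m\<close> coprime to \<open>N\<close>. If \<open>N = p n\<close> with \<open>p\<close> dividing
  \<open>n\<close>, then \<open>S_N\<close> is \<open>S_n\<close> times a power of the \<open>p\<close>-core generating function
  \<open>C_p(Q) = E(Q^p)^p / E(Q)\<close> at \<open>Q = q^n\<close>; if \<open>N = p\<close>, it is \<open>C_p(q)\<close>. If \<open>p\<close> does not divide
  \<open>n \<ge> 3\<close>, the residues prime to \<open>n\<close> pair up as \<open>a, n - a\<close>, and each pair contributes
  \<open>E(Q^p)^(2p-2) [z^p;Q^p] / [z;Q]\<close> with \<open>z = q^a\<close>, \<open>Q = q^n\<close>.

  By the Jacobi triple product, \<open>C_p(Q)\<close> is the sum of \<open>Q^w(n)\<close> over the integer vectors \<open>n\<close> of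
  length \<open>p\<close> with sum 0, where \<open>w(n) = \<Sum>(p n_i (n_i - 1)/2 + i n_i) \<ge> 0\<close>. Marking one coordinate,
  \<open>A(z) = \<Sum>_n \<Sum>_j Q^w(n) z^(p n_j + j)\<close> satisfies \<open>A(Qz) = z^(1-p) A(z)\<close>, equals \<open>p C_p(Q)\<close> at
  \<open>z = 1\<close> and vanishes at the other \<open>p\<close>-th roots of unity. This forces each pair to contribute
  \<open>A(z) C_p(Q)\<close>, a sum of nonnegative powers of \<open>q\<close>. The remaining case \<open>n = 2\<close> is the case
  \<open>N = 2 n\<close> with \<open>n\<close> an odd prime.
\<close>

section \<open>Infinite products\<close>

text \<open>The exponent of \<open>Q\<close> in the theta series, for all integers \<open>n\<close>.
  Since \<open>n * (n - 1)\<close> is even, the division is exact.\<close>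

definition tri :: "int \<Rightarrow> int" where
  "tri n = n * (n - 1) div 2"

lemma two_tri: "2 * tri n = n * (n - 1)"
  unfolding tri_def by (simp add: even_mult_iff)

lemma tri_add: "tri (m + n) = tri m + tri n + m * n"
  using two_tri[of "m + n"] two_tri[of m] two_tri[of n] by (simp add: algebra_simps)

lemma tri_0 [simp]: "tri 0 = 0" and tri_1 [simp]: "tri 1 = 0"
  by (simp_all add: tri_def)

lemma tri_minus: "tri (- n) = tri n + n"
  using two_tri[of "- n"] two_tri[of n] by (simp add: algebra_simps)

lemma tri_nonneg: "tri n \<ge> 0"
proof -
  have "n * (n - 1) \<ge> 0"
    by (cases "n \<ge> 1") (auto intro: mult_nonneg_nonneg mult_nonpos_nonpos)
  thus ?thesis unfolding tri_def by simp
qed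

text \<open>The infinite q-Pochhammer symbol \<open>(z; Q)\<close>.\<close>

definition qpoch :: "complex \<Rightarrow> complex \<Rightarrow> complex" where
  "qpoch z Q = (\<Prod>n. 1 - z * Q ^ n)"

lemma convergent_qpoch:
  fixes z Q :: complex
  assumes "norm Q < 1"
  shows "convergent_prod (\<lambda>n. 1 - z * Q ^ n)"
proof -
  have "summable (\<lambda>n. norm z * norm Q ^ n)"
    using assms by (intro summable_mult summable_geometric) auto
  hence "summable (\<lambda>n. norm ((1 - z * Q ^ n) - 1))"
    by (simp add: norm_mult norm_power)
  hence "abs_convergent_prod (\<lambda>n. 1 - z * Q ^ n)"
    by (rule summable_imp_abs_convergent_prod)
  thus ?thesis by (rule abs_convergent_prod_imp_convergent_prod)
qed

lemma qpoch_has_prod: "norm Q < 1 \<Longrightarrow> (\<lambda>n. 1 - z * Q ^ n) has_prod qpoch z Q"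
  unfolding qpoch_def by (rule convergent_prod_has_prod[OF convergent_qpoch])

lemma qpoch_LIMSEQ:
  assumes "norm Q < 1"
  shows "(\<lambda>n. \<Prod>k<n. 1 - z * Q ^ k) \<longlonglongrightarrow> qpoch z Q"
  using has_prod_imp_tendsto'[OF qpoch_has_prod[OF assms]] .

lemma qpoch_rec:
  assumes "norm Q < 1"
  shows "qpoch z Q = (1 - z) * qpoch (z * Q) Q"
proof -
  have "(\<lambda>n. \<Prod>k<Suc n. 1 - z * Q ^ k) \<longlonglongrightarrow> qpoch z Q"
    using LIMSEQ_Suc[OF qpoch_LIMSEQ[OF assms]] .
  moreover have "(\<Prod>k<Suc n. 1 - z * Q ^ k) = (1 - z) * (\<Prod>k<n. 1 - (z * Q) * Q ^ k)" for n
    by (subst prod.lessThan_Suc_shift) (simp add: mult_ac)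
  moreover have "(\<lambda>n. (1 - z) * (\<Prod>k<n. 1 - (z * Q) * Q ^ k)) \<longlonglongrightarrow> (1 - z) * qpoch (z * Q) Q"
    by (intro tendsto_intros qpoch_LIMSEQ assms)
  ultimately show ?thesis using LIMSEQ_unique by fastforce
qed

lemma qpoch_nonzero:
  assumes "norm Q < 1" "\<And>n. z * Q ^ n \<noteq> 1"
  shows "qpoch z Q \<noteq> 0"
  unfolding qpoch_def
  by (rule prodinf_nonzero[OF convergent_qpoch[OF assms(1)]]) (metis assms(2) right_minus_eq)

lemma qpoch_nonzero':
  assumes "norm Q < 1" "norm z < 1"
  shows "qpoch z Q \<noteq> 0"
proof (rule qpoch_nonzero[OF assms(1)])
  fix n
  have "norm (z * Q ^ n) \<le> norm z"
    using assms by (simp add: norm_mult norm_power mult_left_le power_le_one)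
  thus "z * Q ^ n \<noteq> 1" using assms by fastforce
qed

text \<open>The factors are sorted by the residue of the exponent modulo \<open>m\<close>. The
  regrouped partial products are those of length \<open>n * m\<close>, a subsequence with the same
  limit.\<close>

lemma qpoch_multisection:
  assumes "norm Q < 1" "m > 0"
  shows "qpoch z Q = (\<Prod>i<m. qpoch (z * Q ^ i) (Q ^ m))"
proof -
  have "norm (Q ^ m) < 1"
    using assms by (simp add: norm_power power_less_one_iff)
  hence "(\<lambda>n. \<Prod>i<m. \<Prod>k<n. 1 - (z * Q ^ i) * (Q ^ m) ^ k) \<longlonglongrightarrow> (\<Prod>i<m. qpoch (z * Q ^ i) (Q ^ m))"
    by (intro tendsto_prod qpoch_LIMSEQ)
  also have "(\<lambda>n. \<Prod>i<m. \<Prod>k<n. 1 - (z * Q ^ i) * (Q ^ m) ^ k) = (\<lambda>n. \<Prod>k<n * m. 1 - z * Q ^ k)"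
  proof
    fix n
    have "(\<Prod>i<m. \<Prod>k<n. 1 - (z * Q ^ i) * (Q ^ m) ^ k) = (\<Prod>k<n. \<Prod>i<m. 1 - z * Q ^ (i + k * m))"
      by (subst prod.swap) (simp add: power_add power_mult [symmetric] mult_ac)
    also have "\<dots> = (\<Prod>k<n * m. 1 - z * Q ^ k)"
    proof (induction n)
      case (Suc n)
      have "(\<Prod>k<Suc n * m. 1 - z * Q ^ k) = (\<Prod>k\<in>{..<n*m} \<union> {n*m..<n*m+m}. 1 - z * Q ^ k)"
        by (intro prod.cong) auto
      also have "\<dots> = (\<Prod>k<n * m. 1 - z * Q ^ k) * (\<Prod>k\<in>{n*m..<n*m+m}. 1 - z * Q ^ k)"
        by (intro prod.union_disjoint) auto
      also have "(\<Prod>k\<in>{n*m..<n*m+m}. 1 - z * Q ^ k) = (\<Prod>i<m. 1 - z * Q ^ (i + n * m))"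
        by (rule prod.reindex_bij_witness[of _ "\<lambda>i. i + n * m" "\<lambda>i. i - n * m"]) auto
      finally show ?case using Suc by simp
    qed auto
    finally show "(\<Prod>i<m. \<Prod>k<n. 1 - (z * Q ^ i) * (Q ^ m) ^ k) = (\<Prod>k<n * m. 1 - z * Q ^ k)" .
  qed
  finally have "(\<lambda>n. \<Prod>k<n * m. 1 - z * Q ^ k) \<longlonglongrightarrow> (\<Prod>i<m. qpoch (z * Q ^ i) (Q ^ m))" .
  moreover have "(\<lambda>n. \<Prod>k<n * m. 1 - z * Q ^ k) \<longlonglongrightarrow> qpoch z Q"
  proof (rule filterlim_compose[OF qpoch_LIMSEQ[OF assms(1)]])
    show "filterlim (\<lambda>n. n * m) at_top sequentially"
      using assms by (intro filterlim_subseq strict_monoI) auto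
  qed
  ultimately show ?thesis using LIMSEQ_unique by blast
qed

text \<open>Continuity in \<open>z\<close> serves the limit \<open>z\<close> to 1 in
  \<open>marked_core_sum_identity\<close>. The Weierstrass M-test gives uniform convergence on every
  disc, and the discs cover the plane.\<close>

lemma continuous_on_qpoch:
  assumes "norm Q < 1"
  shows "continuous_on UNIV (\<lambda>z. qpoch z Q)"
proof -
  have "continuous_on (cball 0 R) (\<lambda>z. qpoch z Q)" for R :: real
  proof (rule uniform_limit_theorem)
    have unif: "uniformly_convergent_on (cball 0 R) (\<lambda>N z. \<Prod>n<N. 1 + (- z * Q ^ n))"
    proof (rule uniformly_convergent_on_prod)
      show "uniformly_convergent_on (cball 0 R) (\<lambda>N x. \<Sum>n<N. norm (- x * Q ^ n))"
      proof (rule Weierstrass_m_test')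
        show "norm (norm (- x * Q ^ n)) \<le> \<bar>R\<bar> * norm Q ^ n" if "x \<in> cball 0 R" for x :: complex and n
          using that by (auto simp: norm_mult norm_power intro!: mult_right_mono)
        show "summable (\<lambda>n. \<bar>R\<bar> * norm Q ^ n)"
          using assms by (intro summable_mult summable_geometric) auto
      qed
    qed (auto intro!: continuous_intros)
    have "uniform_limit (cball 0 R) (\<lambda>N z. \<Prod>n<N. 1 + (- z * Q ^ n)) (\<lambda>z. lim (\<lambda>N. \<Prod>n<N. 1 + (- z * Q ^ n))) sequentially"
      using unif uniformly_convergent_uniform_limit_iff by blast
    also have "?this \<longleftrightarrow> uniform_limit (cball 0 R) (\<lambda>N z. \<Prod>n<N. 1 - z * Q ^ n) (\<lambda>z. qpoch z Q) sequentially"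
      using limI[OF qpoch_LIMSEQ[OF assms]] by (intro uniform_limit_cong') auto
    finally show "uniform_limit (cball 0 R) (\<lambda>N z. \<Prod>n<N. 1 - z * Q ^ n) (\<lambda>z. qpoch z Q) sequentially" .
  qed (auto intro!: always_eventually continuous_intros)
  hence "continuous_on (ball 0 R) (\<lambda>z. qpoch z Q)" for R :: real
    by (rule continuous_on_subset[of "cball 0 R"]) auto
  hence "continuous_on (\<Union>R\<in>UNIV. ball 0 (R::real)) (\<lambda>z. qpoch z Q)"
    by (intro continuous_on_open_UN) auto
  moreover have "x \<in> ball 0 (norm x + 1)" for x :: complex
    by simp
  hence "(\<Union>R\<in>UNIV. ball (0::complex) (R::real)) = UNIV"
    by blast
  ultimately show ?thesis by simp
qed

lemma tendsto_qpoch: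
  assumes "norm Q < 1" "(f \<longlongrightarrow> z) F"
  shows "((\<lambda>x. qpoch (f x) Q) \<longlongrightarrow> qpoch z Q) F"
proof -
  have "isCont (\<lambda>z. qpoch z Q) z"
    using continuous_on_qpoch[OF assms(1)] by (simp add: continuous_on_eq_continuous_at)
  thus ?thesis using isCont_tendsto_compose assms(2) by blast
qed

text \<open>Euler's function \<open>E(Q)\<close>: the eta function without its factor
  \<open>q^(1/24)\<close>, not to be confused with the totient.\<close>

definition euler_phi :: "complex \<Rightarrow> complex" where
  "euler_phi Q = qpoch Q Q"

lemma euler_phi_nonzero: "norm Q < 1 \<Longrightarrow> euler_phi Q \<noteq> 0"
  unfolding euler_phi_def by (rule qpoch_nonzero')

text \<open>The modified theta function \<open>[z;Q]\<close>; its zeros in \<open>z\<close> are the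
  integer powers of \<open>Q\<close>.\<close>

definition theta_prod :: "complex \<Rightarrow> complex \<Rightarrow> complex" where
  "theta_prod z Q = qpoch z Q * qpoch (Q / z) Q"

section \<open>The Jacobi triple product\<close>

definition theta_term :: "complex \<Rightarrow> complex \<Rightarrow> int \<Rightarrow> complex" where
  "theta_term w Q n = w powi n * Q powi tri n"

definition theta :: "complex \<Rightarrow> complex \<Rightarrow> complex" where
  "theta w Q = (\<Sum>\<^sub>\<infinity>n. theta_term w Q n)"

lemma theta_term_minus:
  assumes "Q \<noteq> 0" "w \<noteq> 0"
  shows "theta_term w Q (- n) = theta_term (Q / w) Q n"
  using assms by (simp add: theta_term_def tri_minus power_int_add power_int_minus
      power_int_divide_distrib field_simps)

text \<open>This recursion fixes a sequence up to a constant factor, which is how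
  \<open>theta_decomposition\<close> recognises a theta series.\<close>

lemma theta_term_Suc:
  assumes "Q \<noteq> 0" "w \<noteq> 0"
  shows "theta_term w Q (n + 1) = w * Q powi n * theta_term w Q n"
  using assms by (simp add: theta_term_def tri_add power_int_add)

lemma summable_theta_nat:
  assumes "norm Q < 1" "Q \<noteq> 0" "w \<noteq> 0"
  shows "summable (\<lambda>n. norm (theta_term w Q (int n)))"
proof -
  have "(\<lambda>n. norm w * norm Q ^ n) \<longlonglongrightarrow> norm w * 0"
    using assms by (intro tendsto_intros LIMSEQ_power_zero) auto
  hence "eventually (\<lambda>n. norm w * norm Q ^ n < 1 / 2) sequentially"
    by (rule order_tendstoD) auto
  then obtain N where N: "\<And>n. n \<ge> N \<Longrightarrow> norm w * norm Q ^ n < 1 / 2"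
    by (auto simp: eventually_at_top_linorder)
  show ?thesis
  proof (rule summable_ratio_test[of "1/2" N])
    fix n assume n: "n \<ge> N"
    have "theta_term w Q (int (Suc n)) = w * Q ^ n * theta_term w Q (int n)"
      using theta_term_Suc[OF assms(2,3), of "int n"] by (simp add: add.commute)
    hence "norm (theta_term w Q (int (Suc n))) = (norm w * norm Q ^ n) * norm (theta_term w Q (int n))"
      by (simp add: norm_mult norm_power)
    also have "\<dots> \<le> 1 / 2 * norm (theta_term w Q (int n))"
      using N[OF n] by (intro mult_right_mono) auto
    finally show "norm (norm (theta_term w Q (int (Suc n)))) \<le> 1 / 2 * norm (norm (theta_term w Q (int n)))"
      by simp
  qed auto
qed

lemma summable_theta_neg:
  assumes "norm Q < 1" "Q \<noteq> 0" "w \<noteq> 0"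
  shows "summable (\<lambda>n. norm (theta_term w Q (- int (Suc n))))"
proof -
  have "summable (\<lambda>n. norm (theta_term (Q / w) Q (int (Suc n))))"
    using summable_theta_nat[of Q "Q / w"] assms by (subst summable_Suc_iff) auto
  thus ?thesis by (subst theta_term_minus) (use assms in auto)
qed

text \<open>Pairing \<open>n\<close> with \<open>- (n + 1)\<close> turns a sum over all integers
  into an ordinary series, the form that Tannery's theorem needs in the proof of the triple
  product.\<close>

lemma has_sum_int_pairs:
  fixes f :: "int \<Rightarrow> complex"
  assumes "summable (\<lambda>n. norm (f (int n)))" "summable (\<lambda>n. norm (f (- int (Suc n))))"
  shows "(f has_sum (\<Sum>n. f (int n) + f (- int (Suc n)))) UNIV"
proof -
  have 1: "(f has_sum (\<Sum>n. f (int n))) (range int)"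
    using norm_summable_imp_has_sum[OF assms(1)] assms(1)
    by (subst has_sum_reindex) (auto simp: o_def summable_norm_cancel summable_sums)
  have 2: "(f has_sum (\<Sum>n. f (- int (Suc n)))) (range (\<lambda>n. - int (Suc n)))"
    using norm_summable_imp_has_sum[OF assms(2)] assms(2)
    by (subst has_sum_reindex) (auto simp: o_def summable_norm_cancel summable_sums inj_on_def)
  have "n \<in> range int \<union> range (\<lambda>n. - int (Suc n))" for n :: int
    by (cases n) auto
  hence "UNIV = range int \<union> range (\<lambda>n. - int (Suc n))" by blast
  moreover have "range int \<inter> range (\<lambda>n. - int (Suc n)) = {}" by auto
  moreover have "(\<Sum>n. f (int n) + f (- int (Suc n))) = (\<Sum>n. f (int n)) + (\<Sum>n. f (- int (Suc n)))"
    using assms by (intro suminf_add [symmetric]) (auto intro: summable_norm_cancel)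
  ultimately show ?thesis using has_sum_Un_disjoint[OF 1 2] by simp
qed

lemma theta_has_sum:
  assumes "norm Q < 1" "Q \<noteq> 0" "w \<noteq> 0"
  shows "(theta_term w Q has_sum theta w Q) UNIV"
  unfolding theta_def
  using has_sum_int_pairs[OF summable_theta_nat[OF assms] summable_theta_neg[OF assms]]
  by (simp add: has_sum_iff)

lemma theta_eq_suminf:
  assumes "norm Q < 1" "Q \<noteq> 0" "w \<noteq> 0"
  shows "theta w Q = (\<Sum>n. theta_term w Q (int n) + theta_term w Q (- int (Suc n)))"
  using has_sum_int_pairs[OF summable_theta_nat[OF assms] summable_theta_neg[OF assms]]
    theta_has_sum[OF assms] has_sum_unique by blast

section \<open>Gaussian binomial coefficients and the triple product\<close>

definition qfact :: "complex \<Rightarrow> nat \<Rightarrow> complex" where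
  "qfact Q n = (\<Prod>i<n. 1 - Q ^ Suc i)"

lemma qfact_nonzero:
  assumes "norm Q < 1"
  shows "qfact Q n \<noteq> 0"
proof -
  have "1 - Q ^ Suc i \<noteq> 0" for i
  proof -
    have "norm (Q ^ Suc i) < 1"
      using assms by (subst norm_power, subst power_less_one_iff) auto
    thus ?thesis by fastforce
  qed
  thus ?thesis unfolding qfact_def by (simp del: power_Suc)
qed

lemma qfact_Suc: "qfact Q (Suc n) = (1 - Q ^ Suc n) * qfact Q n"
  by (simp add: qfact_def mult.commute)

lemma qfact_0 [simp]: "qfact Q 0 = 1"
  by (simp add: qfact_def)

definition gauss_binomial :: "complex \<Rightarrow> nat \<Rightarrow> nat \<Rightarrow> complex" where
  "gauss_binomial Q n k = (if k \<le> n then qfact Q n / (qfact Q k * qfact Q (n - k)) else 0)"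

text \<open>A q-Pascal rule, from
  \<open>1 - Q^(n+1) = (1 - Q^(n-k)) + Q^(n-k) * (1 - Q^(k+1))\<close>. The case
  \<open>k = n\<close> is separate because \<open>gauss_binomial Q n (Suc n)\<close> takes the
  default value 0.\<close>

lemma gauss_binomial_Suc:
  assumes "norm Q < 1" "k \<le> n"
  shows "gauss_binomial Q (Suc n) (Suc k) = gauss_binomial Q n (Suc k) + Q ^ (n - k) * gauss_binomial Q n k"
proof (cases "k = n")
  case True
  thus ?thesis using qfact_nonzero[OF assms(1)] by (simp add: gauss_binomial_def)
next
  case False
  then obtain d where d: "n = Suc (k + d)"
    using assms(2) less_iff_Suc_add by (metis le_neq_implies_less)
  have nd: "n - k = Suc d" "n - Suc k = d" using d by auto
  have pw: "Q ^ n = Q ^ k * Q ^ Suc d" by (simp add: d power_add)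
  have nz: "1 - Q ^ Suc m \<noteq> 0" for m
    using qfact_nonzero[OF assms(1), of "Suc m"] by (simp add: qfact_Suc)
  have e: "Q ^ Suc n = Q * (Q ^ k * Q ^ Suc d)" by (simp add: pw)
  have "gauss_binomial Q (Suc n) (Suc k) = qfact Q n * (1 - Q ^ Suc n) / (qfact Q (Suc k) * qfact Q (Suc d))"
    using d by (simp add: gauss_binomial_def nd qfact_Suc)
  moreover have "gauss_binomial Q n (Suc k) = qfact Q n * (1 - Q ^ Suc d) / (qfact Q (Suc k) * qfact Q (Suc d))"
    using d nz[of d] qfact_nonzero[OF assms(1)] by (simp add: gauss_binomial_def nd qfact_Suc[of _ d])
  moreover have "gauss_binomial Q n k = qfact Q n * (1 - Q ^ Suc k) / (qfact Q (Suc k) * qfact Q (Suc d))"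
    using d nz[of k] qfact_nonzero[OF assms(1)] by (simp add: gauss_binomial_def nd qfact_Suc[of _ k])
  moreover have "qfact Q n * (1 - Q ^ Suc n) = qfact Q n * (1 - Q ^ Suc d) + Q ^ Suc d * (qfact Q n * (1 - Q ^ Suc k))"
    by (subst e) (simp add: algebra_simps)
  ultimately show ?thesis
    by (simp add: nd add_divide_distrib)
qed

text \<open>Cauchy's q-binomial theorem. The new factor \<open>1 + x * Q ^ n\<close> of the
  induction step matches the two terms of \<open>gauss_binomial_Suc\<close>, because
  \<open>Q ^ k * Q ^ (n - k) = Q ^ n\<close>.\<close>

lemma gauss_binomial_theorem:
  assumes "norm Q < 1" "Q \<noteq> 0"
  shows "(\<Prod>j<n. 1 + x * Q ^ j) = (\<Sum>k\<le>n. x ^ k * Q powi tri (int k) * gauss_binomial Q n k)"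
proof (induction n)
  case 0
  show ?case by (simp add: gauss_binomial_def)
next
  case (Suc n)
  let ?g = "\<lambda>n k. x ^ k * Q powi tri (int k) * gauss_binomial Q n k"
  have rec: "?g (Suc n) (Suc k) = ?g n (Suc k) + x * Q ^ n * ?g n k" if "k \<le> n" for k
  proof -
    have "Q powi tri (int (Suc k)) = Q powi tri (int k) * Q ^ k"
      using tri_add[of "int k" 1] assms(2) by (simp add: power_int_add add.commute)
    moreover have "Q ^ n = Q ^ k * Q ^ (n - k)"
      using that by (simp flip: power_add)
    ultimately show ?thesis
      by (simp add: gauss_binomial_Suc[OF assms(1) that] algebra_simps)
  qed
  have "(\<Sum>k\<le>Suc n. ?g (Suc n) k) = ?g (Suc n) 0 + (\<Sum>k\<le>n. ?g (Suc n) (Suc k))"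
    by (rule sum.atMost_Suc_shift)
  also have "?g (Suc n) 0 = ?g n 0"
    using qfact_nonzero[OF assms(1)] by (simp add: gauss_binomial_def)
  also have "(\<Sum>k\<le>n. ?g (Suc n) (Suc k)) = (\<Sum>k\<le>n. ?g n (Suc k)) + x * Q ^ n * (\<Sum>k\<le>n. ?g n k)"
    by (simp add: rec sum.distrib sum_distrib_left del: power_Suc of_nat_Suc)
  also have "?g n 0 + ((\<Sum>k\<le>n. ?g n (Suc k)) + x * Q ^ n * (\<Sum>k\<le>n. ?g n k)) =
      (?g n 0 + (\<Sum>k\<le>n. ?g n (Suc k))) + x * Q ^ n * (\<Sum>k\<le>n. ?g n k)"
    by simp
  also have "?g n 0 + (\<Sum>k\<le>n. ?g n (Suc k)) = (\<Sum>k\<le>Suc n. ?g n k)"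
    by (rule sum.atMost_Suc_shift [symmetric])
  also have "\<dots> = (\<Sum>k\<le>n. ?g n k)"
    by (simp add: gauss_binomial_def)
  finally show ?case using Suc by (simp add: algebra_simps)
qed

text \<open>The q-binomial theorem is applied to \<open>2 * m\<close> factors at
  \<open>x = - z * Q^(-m)\<close>. The upper \<open>m\<close> factors form the first product;
  multiplying the lower ones, in reverse order, by \<open>- Q^(j+1) / z\<close> turns them into the
  second. \<open>D m\<close> collects these multipliers.\<close>

lemma finite_triple_product:
  assumes "norm Q < 1" "Q \<noteq> 0" "z \<noteq> 0"
  shows "(\<Prod>j<m. 1 - z * Q ^ j) * (\<Prod>j<m. 1 - Q / z * Q ^ j) =
    (\<Sum>k\<le>2*m. theta_term (-z) Q (int k - int m) * gauss_binomial Q (2*m) k)"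
proof -
  define x where "x = - z * Q powi (- int m)"
  define D where "D = (\<lambda>m. \<Prod>j<m. - (Q ^ Suc j) / z)"
  have D: "D n = (- z) powi (- int n) * Q powi tri (int n + 1)" for n
  proof (induction n)
    case (Suc n)
    have "D (Suc n) = D n * (- (Q ^ Suc n) / z)" by (simp add: D_def)
    also have "\<dots> = (- z) powi (- int n) * Q powi tri (int n + 1) * ((-z) powi (-1) * Q powi (int n + 1))"
    proof -
      have "Q powi (int n + 1) = Q ^ Suc n"
        using power_int_of_nat[of Q "Suc n"] by (simp only: of_nat_Suc add.commute)
      thus ?thesis unfolding Suc by (simp add: power_int_minus divide_inverse mult_ac)
    qed
    also have "\<dots> = ((- z) powi (- int n) * (-z) powi (-1)) * (Q powi tri (int n + 1) * Q powi (int n + 1))"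
      by (simp only: mult_ac)
    also have "\<dots> = (- z) powi (- int n + (-1)) * Q powi (tri (int n + 1) + (int n + 1))"
      using assms by (subst (1 2) power_int_add) auto
    also have "tri (int n + 1) + (int n + 1) = tri (int (Suc n) + 1)"
      using tri_add[of "int n + 1" 1] by (simp add: add.commute)
    also have "- int n + (-1) = - int (Suc n)" by simp
    finally show ?case .
  qed (simp add: D_def)
  have "(\<Prod>j<2*m. 1 + x * Q ^ j) = (\<Prod>j<m. 1 + x * Q ^ j) * (\<Prod>j<m. 1 + x * Q ^ (m + j))"
  proof -
    have "(\<Prod>j<2*m. 1 + x * Q ^ j) = (\<Prod>j\<in>{..<m} \<union> {m..<m+m}. 1 + x * Q ^ j)"
      by (intro prod.cong) auto
    also have "\<dots> = (\<Prod>j<m. 1 + x * Q ^ j) * (\<Prod>j\<in>{m..<m+m}. 1 + x * Q ^ j)"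
      by (intro prod.union_disjoint) auto
    also have "(\<Prod>j\<in>{m..<m+m}. 1 + x * Q ^ j) = (\<Prod>j<m. 1 + x * Q ^ (m + j))"
      by (rule prod.reindex_bij_witness[of _ "\<lambda>j. m + j" "\<lambda>j. j - m"]) auto
    finally show ?thesis .
  qed
  also have "(\<Prod>j<m. 1 + x * Q ^ (m + j)) = (\<Prod>j<m. 1 - z * Q ^ j)"
    using assms by (intro prod.cong) (auto simp: x_def power_int_minus power_add)
  also have "(\<Prod>j<m. 1 + x * Q ^ j) = (\<Prod>j<m. 1 + x * Q ^ (m - Suc j))"
    by (rule prod.nat_diff_reindex [symmetric])
  finally have "D m * (\<Prod>j<2*m. 1 + x * Q ^ j) =
      (\<Prod>j<m. (- (Q ^ Suc j) / z) * (1 + x * Q ^ (m - Suc j))) * (\<Prod>j<m. 1 - z * Q ^ j)"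
    by (simp only: D_def prod.distrib mult.assoc)
  also have "(\<Prod>j<m. (- (Q ^ Suc j) / z) * (1 + x * Q ^ (m - Suc j))) = (\<Prod>j<m. 1 - Q / z * Q ^ j)"
  proof (intro prod.cong refl)
    fix j assume "j \<in> {..<m}"
    hence "Q ^ m = Q ^ Suc j * Q ^ (m - Suc j)" by (subst power_add [symmetric]) simp
    thus "(- (Q ^ Suc j) / z) * (1 + x * Q ^ (m - Suc j)) = 1 - Q / z * Q ^ j"
      using assms by (simp add: x_def power_int_minus field_simps)
  qed
  finally have "(\<Prod>j<m. 1 - z * Q ^ j) * (\<Prod>j<m. 1 - Q / z * Q ^ j) = D m * (\<Prod>j<2*m. 1 + x * Q ^ j)"
    by simp
  also have "\<dots> = (\<Sum>k\<le>2*m. D m * (x ^ k * Q powi tri (int k)) * gauss_binomial Q (2*m) k)"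
    by (simp add: gauss_binomial_theorem[OF assms(1,2)] sum_distrib_left mult_ac)
  also have "\<dots> = (\<Sum>k\<le>2*m. theta_term (-z) Q (int k - int m) * gauss_binomial Q (2*m) k)"
  proof (intro sum.cong refl)
    fix k
    have x: "x ^ k = (-z) powi int k * Q powi (- int m * int k)"
      unfolding x_def power_mult_distrib by (simp only: power_int_power' power_int_of_nat)
    have "D m * (x ^ k * Q powi tri (int k)) =
      ((-z) powi (- int m) * (-z) powi int k) * (Q powi tri (int m + 1) * Q powi (- int m * int k) * Q powi tri (int k))"
      by (simp only: D x mult_ac)
    also have "\<dots> = (-z) powi (- int m + int k) * Q powi (tri (int m + 1) + - int m * int k + tri (int k))"
      using assms by (simp only: power_int_add[of Q, OF disjI1] power_int_add[of "-z", OF disjI1] neg_equal_0_iff_equal not_False_eq_True)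
    also have "tri (int m + 1) + - int m * int k + tri (int k) = tri (- int m + int k)"
      using tri_add[of "int m" 1] tri_add[of "- int m" "int k"] tri_minus[of "int m"] by simp
    finally show "D m * (x ^ k * Q powi tri (int k)) * gauss_binomial Q (2*m) k =
        theta_term (-z) Q (int k - int m) * gauss_binomial Q (2*m) k"
      by (simp add: theta_term_def algebra_simps)
  qed
  finally show ?thesis .
qed

text \<open>The limit of the finite identity as \<open>m\<close> grows: each
  \<open>gauss_binomial Q (2*m) (m+l)\<close> tends to \<open>1 / E(Q)\<close>, and Tannery's
  theorem moves the limit inside the sum.\<close>

theorem jacobi_triple_product:
  assumes "norm Q < 1" "Q \<noteq> 0" "z \<noteq> 0"
  shows "theta (-z) Q = euler_phi Q * theta_prod z Q"
proof -
  \<comment> \<open>The summands of the finite identity, re-indexed by \<open>l = k - m\<close> and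
    set to 0 outside \<open>- m \<le> l \<le> m\<close>.\<close>
  define c where "c = (\<lambda>m l. if \<bar>l\<bar> \<le> int m then theta_term (-z) Q l * gauss_binomial Q (2*m) (nat (l + int m)) else 0)"
  define a where "a = (\<lambda>k m. c m (int k) + c m (- int (Suc k)))"
  have qf: "qfact Q \<longlonglongrightarrow> euler_phi Q"
    using qpoch_LIMSEQ[OF assms(1), of Q] by (simp add: qfact_def [abs_def] euler_phi_def)
  have E: "euler_phi Q \<noteq> 0" by (rule euler_phi_nonzero[OF assms(1)])
  \<comment> \<open>\<open>qfact Q\<close> converges to the nonzero \<open>E(Q)\<close>, so it and
    its inverse are bounded. This bounds all Gaussian binomials at once.\<close>
  obtain U where U: "\<And>n. norm (qfact Q n) \<le> U" "U > 0"
    using convergent_imp_Bseq[OF convergentI[OF qf]] by (auto simp: Bseq_def)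
  obtain V where V: "\<And>n. norm (inverse (qfact Q n)) \<le> V" "V > 0"
    using convergent_imp_Bseq[OF convergentI[OF tendsto_inverse[OF qf E]]] by (auto simp: Bseq_def)
  have gb: "norm (gauss_binomial Q n k) \<le> U * V * V" for n k
  proof (cases "k \<le> n")
    case True
    have "norm (gauss_binomial Q n k) = norm (qfact Q n) * norm (inverse (qfact Q k)) * norm (inverse (qfact Q (n - k)))"
      using True by (simp add: gauss_binomial_def norm_mult norm_divide norm_inverse field_simps)
    also have "\<dots> \<le> U * V * V"
      using U V by (intro mult_mono) auto
    finally show ?thesis .
  qed (use U V in \<open>simp add: gauss_binomial_def\<close>)
  have clim: "(\<lambda>m. c m l) \<longlonglongrightarrow> theta_term (-z) Q l / euler_phi Q" for l
  proof -
    have m1: "filterlim (\<lambda>m. 2 * m) at_top (sequentially :: nat filter)"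
      by (intro filterlim_subseq strict_monoI) auto
    have m2: "filterlim (\<lambda>m. nat (l + int m)) at_top sequentially" for l
      unfolding filterlim_at_top
    proof
      fix Z :: nat
      show "eventually (\<lambda>m. Z \<le> nat (l + int m)) sequentially"
        using eventually_ge_at_top[of "Z + nat \<bar>l\<bar>"] by eventually_elim linarith
    qed
    have "(\<lambda>m. theta_term (-z) Q l * (qfact Q (2*m) / (qfact Q (nat (l + int m)) * qfact Q (nat (- l + int m)))))
        \<longlonglongrightarrow> theta_term (-z) Q l * (euler_phi Q / (euler_phi Q * euler_phi Q))"
      using E by (intro tendsto_intros filterlim_compose[OF qf m1] filterlim_compose[OF qf m2]) auto
    also have "theta_term (-z) Q l * (euler_phi Q / (euler_phi Q * euler_phi Q)) = theta_term (-z) Q l / euler_phi Q"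
      using E by simp
    finally show ?thesis
    proof (rule Lim_transform_eventually)
      show "\<forall>\<^sub>F m in sequentially. theta_term (-z) Q l * (qfact Q (2*m) / (qfact Q (nat (l + int m)) * qfact Q (nat (- l + int m)))) = c m l"
        using eventually_ge_at_top[of "nat \<bar>l\<bar>"]
      proof eventually_elim
        case (elim m)
        have "nat (- l + int m) = 2 * m - nat (l + int m)" "nat (l + int m) \<le> 2 * m"
          using elim by auto
        thus ?case using elim by (auto simp: c_def gauss_binomial_def)
      qed
    qed
  qed
  define M where "M = (\<lambda>k. (U * V * V) * norm (theta_term (-z) Q (int k)) + (U * V * V) * norm (theta_term (-z) Q (- int (Suc k))))"
  have cb: "norm (c m l) \<le> (U * V * V) * norm (theta_term (-z) Q l)" for m l
    using gb[of "2*m" "nat (l + int m)"] U V by (auto simp: c_def norm_mult mult.commute[of "norm (theta_term _ _ _)"] intro!: mult_right_mono)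
  have "(\<lambda>m. \<Sum>k. a k m) \<longlonglongrightarrow> (\<Sum>k. (theta_term (-z) Q (int k) + theta_term (-z) Q (- int (Suc k))) / euler_phi Q)"
  proof (rule tannerys_theorem[THEN conjunct2, THEN conjunct2])
    show "(\<lambda>m. a k m) \<longlonglongrightarrow> (theta_term (-z) Q (int k) + theta_term (-z) Q (- int (Suc k))) / euler_phi Q" for k
      unfolding a_def add_divide_distrib by (intro tendsto_intros clim)
    show "\<forall>\<^sub>F (k, n) in at_top \<times>\<^sub>F sequentially. norm (a k n) \<le> M k"
      unfolding a_def M_def
      by (intro always_eventually) (auto intro!: norm_triangle_le add_mono cb simp del: of_nat_Suc)
    show "summable M"
      unfolding M_def using assms
      by (intro summable_add summable_mult summable_theta_nat summable_theta_neg) auto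
  qed auto
  also have "(\<Sum>k. (theta_term (-z) Q (int k) + theta_term (-z) Q (- int (Suc k))) / euler_phi Q) = theta (-z) Q / euler_phi Q"
    using theta_eq_suminf[of Q "-z"] summable_theta_nat[of Q "-z"] summable_theta_neg[of Q "-z"] assms
    by (subst suminf_divide) (auto intro!: summable_add intro: summable_norm_cancel simp del: of_nat_Suc)
  also have "(\<lambda>m. \<Sum>k. a k m) = (\<lambda>m. (\<Prod>j<m. 1 - z * Q ^ j) * (\<Prod>j<m. 1 - Q / z * Q ^ j))"
  proof
    fix m
    \<comment> \<open>\<open>a k m\<close> is 0 for \<open>k > m\<close>. The last pair,
      \<open>k = m\<close>, also contains \<open>l = - (m + 1)\<close>, where \<open>c\<close> has
      its default value 0.\<close>
    have "(\<Sum>k. a k m) = (\<Sum>k<Suc m. a k m)"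
      by (rule suminf_finite) (auto simp: a_def c_def)
    also have "(\<Sum>k<M. a k m) = (\<Sum>l\<in>{- int M..<int M}. c m l)" for M
    proof (induction M)
      case (Suc M)
      have "{- int (Suc M)..<int (Suc M)} = insert (int M) (insert (- int (Suc M)) {- int M..<int M})"
        by auto
      thus ?case using Suc by (simp add: a_def del: of_nat_Suc)
    qed auto
    also have "(\<Sum>l\<in>{- int (Suc m)..<int (Suc m)}. c m l) = (\<Sum>l\<in>{- int m..int m}. c m l)"
      by (rule sum.mono_neutral_right) (auto simp: c_def)
    also have "\<dots> = (\<Sum>k\<le>2*m. theta_term (-z) Q (int k - int m) * gauss_binomial Q (2*m) k)"
      by (rule sum.reindex_bij_witness[of _ "\<lambda>k. int k - int m" "\<lambda>l. nat (l + int m)"]) (auto simp: c_def)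
    also have "\<dots> = (\<Prod>j<m. 1 - z * Q ^ j) * (\<Prod>j<m. 1 - Q / z * Q ^ j)"
      by (rule finite_triple_product[OF assms, symmetric])
    finally show "(\<Sum>k. a k m) = (\<Prod>j<m. 1 - z * Q ^ j) * (\<Prod>j<m. 1 - Q / z * Q ^ j)" .
  qed
  finally have "(\<lambda>m. (\<Prod>j<m. 1 - z * Q ^ j) * (\<Prod>j<m. 1 - Q / z * Q ^ j)) \<longlonglongrightarrow> theta (-z) Q / euler_phi Q" .
  moreover have "(\<lambda>m. (\<Prod>j<m. 1 - z * Q ^ j) * (\<Prod>j<m. 1 - Q / z * Q ^ j)) \<longlonglongrightarrow> theta_prod z Q"
    unfolding theta_prod_def by (intro tendsto_mult qpoch_LIMSEQ assms)
  ultimately have "theta (-z) Q / euler_phi Q = theta_prod z Q"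
    using LIMSEQ_unique by blast
  thus ?thesis using E by (simp add: field_simps)
qed

section \<open>Quasi-periodic multiple sums as theta functions\<close>

text \<open>For complex numbers, unconditional and absolute summability coincide. Both families are
  therefore absolutely summable, and so is the family of products.\<close>

lemma has_sum_times:
  fixes f :: "'a \<Rightarrow> complex" and g :: "'b \<Rightarrow> complex"
  assumes f: "(f has_sum a) A" and g: "(g has_sum b) B"
  shows "((\<lambda>(x, y). f x * g y) has_sum (a * b)) (A \<times> B)"
proof (rule has_sum_SigmaI)
  have fa: "f abs_summable_on A" and ga: "g abs_summable_on B"
    using f g by (auto simp flip: summable_on_iff_abs_summable_on_complex intro: has_sum_imp_summable)
  show "((\<lambda>y. case (x, y) of (x, y) \<Rightarrow> f x * g y) has_sum f x * b) B" for x
    using has_sum_cmult_right[OF g] by simp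
  show "((\<lambda>x. f x * b) has_sum a * b) A"
    by (rule has_sum_cmult_left[OF f])
  have "(\<lambda>(x, y). f x * g y) abs_summable_on (A \<times> B)"
    unfolding abs_summable_on_Sigma_iff
  proof (intro conjI ballI)
    show "(\<lambda>y. case (x, y) of (x, y) \<Rightarrow> f x * g y) abs_summable_on B" for x
      using summable_on_cmult_right[OF ga, of "norm (f x)"] by (simp add: norm_mult)
    have "(\<lambda>x. norm (f x) * (\<Sum>\<^sub>\<infinity>y\<in>B. norm (g y))) summable_on A"
      by (rule summable_on_cmult_left[OF fa])
    thus "(\<lambda>x. \<Sum>\<^sub>\<infinity>y\<in>B. norm (case (x, y) of (x, y) \<Rightarrow> f x * g y)) abs_summable_on A"
      by (simp add: norm_mult infsum_cmult_right' infsum_nonneg abs_mult)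
  qed
  thus "(\<lambda>(x, y). f x * g y) summable_on (A \<times> B)"
    by (simp add: summable_on_iff_abs_summable_on_complex)
qed

lemma has_sum_prod_PiE:
  fixes f :: "'a \<Rightarrow> 'b \<Rightarrow> complex"
  assumes "finite I" "\<And>i. i \<in> I \<Longrightarrow> (f i has_sum a i) (B i)"
  shows "((\<lambda>n. \<Prod>i\<in>I. f i (n i)) has_sum (\<Prod>i\<in>I. a i)) (PiE I B)"
  using assms
proof (induction I rule: finite_induct)
  case empty
  show ?case by (simp add: PiE_empty_domain has_sum_finite_iff)
next
  case (insert j I)
  have "((\<lambda>(y, n). f j y * (\<Prod>i\<in>I. f i (n i))) has_sum (a j * (\<Prod>i\<in>I. a i))) (B j \<times> PiE I B)"
    using insert by (intro has_sum_times) auto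
  also have "?this \<longleftrightarrow> ((\<lambda>(y, n). \<Prod>i\<in>insert j I. f i ((n(j := y)) i)) has_sum (a j * (\<Prod>i\<in>I. a i))) (B j \<times> PiE I B)"
  proof (intro has_sum_cong, clarify)
    fix y n
    have "(\<Prod>i\<in>I. f i ((n(j := y)) i)) = (\<Prod>i\<in>I. f i (n i))"
      using insert.hyps by (intro prod.cong) auto
    thus "f j y * (\<Prod>i\<in>I. f i (n i)) = (\<Prod>i\<in>insert j I. f i ((n(j := y)) i))"
      using insert.hyps by simp
  qed
  also have "\<dots> \<longleftrightarrow> ((\<lambda>n. \<Prod>i\<in>insert j I. f i (n i)) has_sum (a j * (\<Prod>i\<in>I. a i))) ((\<lambda>(y, n). n(j := y)) ` (B j \<times> PiE I B))"
    using inj_combinator'[OF insert.hyps(2), of B] inj_combinator[OF insert.hyps(2), of B]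
    by (subst has_sum_reindex) (auto simp: o_def case_prod_unfold)
  finally show ?case using insert.hyps by (simp add: PiE_insert_eq)
qed

lemma int_shift_invariant:
  fixes g :: "int \<Rightarrow> 'a"
  assumes "\<And>n. g (n + 1) = g n"
  shows "g n = g 0"
proof (induction n rule: int_induct[where k = 0])
  case (step1 i)
  thus ?case using assms[of i] by simp
next
  case (step2 i)
  thus ?case using assms[of "i - 1"] by simp
qed simp

text \<open>
  The symmetry \<open>T\<close> gives the coefficients of \<open>z^k\<close> the recursion \<open>b(k + p) = s Q^k b(k)\<close>, which is
  that of a theta series in each residue class modulo \<open>p\<close>.
\<close>
theorem theta_decomposition:
  fixes Y :: "'a set" and K :: "'a \<Rightarrow> int" and W :: "'a \<Rightarrow> complex" and z s Q :: complex
  assumes p: "p > 0" and Q: "norm Q < 1" "Q \<noteq> 0" and z: "z \<noteq> 0" and s: "s \<noteq> 0"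
  assumes T: "bij_betw T Y Y"
  assumes KT: "\<And>y. y \<in> Y \<Longrightarrow> K (T y) = K y + int p"
  assumes WT: "\<And>y. y \<in> Y \<Longrightarrow> W (T y) = s * Q powi K y * W y"
  assumes summable: "(\<lambda>y. W y * z powi K y) summable_on Y"
  defines "b \<equiv> \<lambda>k. \<Sum>\<^sub>\<infinity>y\<in>{y\<in>Y. K y = k}. W y"
  shows "((\<lambda>y. W y * z powi K y) has_sum (\<Sum>k<p. b (int k) * z ^ k * theta (s * z ^ p * Q ^ k) (Q ^ p))) Y"
proof -
  define S where "S = (\<Sum>\<^sub>\<infinity>y\<in>Y. W y * z powi K y)"
  have S: "((\<lambda>y. W y * z powi K y) has_sum S) Y"
    using summable by (simp add: S_def)
  have inner: "((\<lambda>y. W y * z powi k) has_sum (b k * z powi k)) {y\<in>Y. K y = k}" for k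
  proof -
    have "(\<lambda>y. W y * z powi K y) summable_on {y\<in>Y. K y = k}"
      using summable by (rule summable_on_subset_banach) auto
    also have "?this \<longleftrightarrow> (\<lambda>y. W y * z powi k) summable_on {y\<in>Y. K y = k}"
      by (intro summable_on_cong) auto
    also have "\<dots> \<longleftrightarrow> W summable_on {y\<in>Y. K y = k}"
      using z by (intro summable_on_cmult_left') auto
    finally show ?thesis unfolding b_def by (intro has_sum_cmult_left) simp
  qed
  have "((\<lambda>(k, y). W y * z powi k) has_sum S) (SIGMA k:UNIV. {y\<in>Y. K y = k})"
    using S by (subst has_sum_reindex_bij_witness[of _ "\<lambda>y. (K y, y)" snd Y "\<lambda>y. W y * z powi K y"]) auto
  hence bz: "((\<lambda>k. b k * z powi k) has_sum S) UNIV"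
    by (rule has_sum_SigmaD) (use inner in auto)
  have b_rec: "b (k + int p) = s * Q powi k * b k" for k
  proof -
    have "bij_betw T {y\<in>Y. K y = k} {y\<in>Y. K y = k + int p}"
      unfolding bij_betw_def
    proof (intro conjI equalityI subsetI)
      show "inj_on T {y \<in> Y. K y = k}"
        using T by (auto simp: bij_betw_def intro: inj_on_subset)
      fix y assume "y \<in> {y \<in> Y. K y = k + int p}"
      moreover from this obtain x where x: "x \<in> Y" "y = T x"
        using T by (auto simp: bij_betw_def)
      ultimately show "y \<in> T ` {y \<in> Y. K y = k}" using KT[OF x(1)] by auto
    qed (use KT bij_betwE[OF T] in auto)
    hence "b (k + int p) = (\<Sum>\<^sub>\<infinity>y\<in>{y\<in>Y. K y = k}. W (T y))"
      unfolding b_def by (rule infsum_reindex_bij_betw [symmetric])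
    also have "\<dots> = (\<Sum>\<^sub>\<infinity>y\<in>{y\<in>Y. K y = k}. s * Q powi k * W y)"
      by (intro infsum_cong) (auto simp: WT)
    also have "\<dots> = s * Q powi k * b k"
      unfolding b_def by (rule infsum_cmult_right')
    finally show ?thesis .
  qed
  have Qp: "norm (Q ^ p) < 1" "Q ^ p \<noteq> 0"
    using Q p by (auto simp: norm_power power_less_one_iff)
  have class_sum: "((\<lambda>n. b (int k + int p * n) * z powi (int k + int p * n)) has_sum
      (b (int k) * z ^ k * theta (s * z ^ p * Q ^ k) (Q ^ p))) UNIV" for k
  proof -
    \<comment> \<open>Passing from \<open>n\<close> to \<open>n + 1\<close> multiplies the summand
      by \<open>s * Q powi (k + p * n) * z ^ p\<close>; \<open>w\<close> is the part of this factor
      free of \<open>n\<close>.\<close>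
    define w where "w = s * z ^ p * Q ^ k"
    have w: "w \<noteq> 0" using s z Q by (simp add: w_def)
    define f where "f = (\<lambda>n. b (int k + int p * n) * z powi (int k + int p * n))"
    have tnz: "theta_term w (Q ^ p) n \<noteq> 0" for n
      using w Qp by (simp add: theta_term_def)
    have f_Suc: "f (n + 1) = w * (Q ^ p) powi n * f n" for n
    proof -
      have "int k + int p * (n + 1) = (int k + int p * n) + int p"
        by (simp add: algebra_simps)
      hence "f (n + 1) = s * Q powi (int k + int p * n) * b (int k + int p * n) * z powi (int k + int p * n + int p)"
        unfolding f_def by (simp only: b_rec)
      also have "\<dots> = w * (Q ^ p) powi n * f n"
        using Q z by (simp add: f_def w_def power_int_add power_int_power mult_ac)
      finally show ?thesis .
    qed
    \<comment> \<open>By \<open>f_Suc\<close> and \<open>theta_term_Suc\<close>, numerator and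
      denominator obey the same recursion.\<close>
    have const: "f n / theta_term w (Q ^ p) n = f 0 / theta_term w (Q ^ p) 0" for n
    proof (rule int_shift_invariant[of "\<lambda>n. f n / theta_term w (Q ^ p) n"])
      fix n
      show "f (n + 1) / theta_term w (Q ^ p) (n + 1) = f n / theta_term w (Q ^ p) n"
        using w Qp Q by (simp add: f_Suc theta_term_Suc)
    qed
    have "theta_term w (Q ^ p) 0 = 1"
      by (simp add: theta_term_def)
    hence "f n = f 0 * theta_term w (Q ^ p) n" for n
      using const[of n] tnz[of n] by (simp add: nonzero_divide_eq_eq)
    moreover have "((\<lambda>n. f 0 * theta_term w (Q ^ p) n) has_sum (f 0 * theta w (Q ^ p))) UNIV"
      by (intro has_sum_cmult_right theta_has_sum Qp w)
    ultimately have "(f has_sum (f 0 * theta w (Q ^ p))) UNIV"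
      using has_sum_cong[of UNIV f "\<lambda>n. f 0 * theta_term w (Q ^ p) n"] by blast
    thus ?thesis by (simp add: f_def w_def)
  qed
  have "((\<lambda>(k, n). b (int k + int p * n) * z powi (int k + int p * n)) has_sum S) ({..<p} \<times> UNIV)"
  proof -
    have "bij_betw (\<lambda>(k, n). int k + int p * n) ({..<p} \<times> UNIV) UNIV"
      using p by (intro bij_betwI[of _ _ _ "\<lambda>m. (nat (m mod int p), m div int p)"])
        (auto simp: nat_less_iff)
    from has_sum_reindex_bij_betw[OF this, of "\<lambda>k. b k * z powi k"] bz show ?thesis
      by (simp add: case_prod_unfold)
  qed
  hence "((\<lambda>k. b (int k) * z ^ k * theta (s * z ^ p * Q ^ k) (Q ^ p)) has_sum S) {..<p}"
    by (rule has_sum_SigmaD) (use class_sum in auto)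
  hence "S = (\<Sum>k<p. b (int k) * z ^ k * theta (s * z ^ p * Q ^ k) (Q ^ p))"
    using has_sum_finite[of "{..<p}"] has_sum_unique by blast
  thus ?thesis using S by simp
qed

section \<open>The core generating function\<close>

text \<open>Functions in \<open>PiE\<close> are \<open>undefined\<close> from \<open>p\<close> on,
  so a vector is determined by its \<open>p\<close> coordinates.\<close>

definition int_vectors :: "nat \<Rightarrow> (nat \<Rightarrow> int) set" where
  "int_vectors p = PiE {..<p} (\<lambda>_. UNIV)"

text \<open>On vectors of sum 0 this equals \<open>p/2 * \<Sum> (n i)^2 + \<Sum> i * n i\<close>,
  the Garvan-Kim-Stanton formula for the size of a \<open>p\<close>-core.\<close>

definition vweight :: "nat \<Rightarrow> (nat \<Rightarrow> int) \<Rightarrow> int" where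
  "vweight p n = (\<Sum>i<p. int p * tri (n i) + int i * n i)"

definition vsum :: "nat \<Rightarrow> (nat \<Rightarrow> int) \<Rightarrow> int" where
  "vsum p n = (\<Sum>i<p. n i)"

text \<open>Adds 1 to each of the numbers \<open>p * n i + i\<close>, which are then re-indexed by
  their residues modulo \<open>p\<close>.\<close>

definition rotate_up :: "nat \<Rightarrow> (nat \<Rightarrow> int) \<Rightarrow> nat \<Rightarrow> int" where
  "rotate_up p n = (\<lambda>i\<in>{..<p}. if i = 0 then n (p - 1) + 1 else n (i - 1))"

definition rotate_down :: "nat \<Rightarrow> (nat \<Rightarrow> int) \<Rightarrow> nat \<Rightarrow> int" where
  "rotate_down p n = (\<lambda>i\<in>{..<p}. if i = p - 1 then n 0 - 1 else n (i + 1))"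

lemma rotate_in_int_vectors [simp]:
  "rotate_up p n \<in> int_vectors p" "rotate_down p n \<in> int_vectors p"
  by (auto simp: int_vectors_def rotate_up_def rotate_down_def)

lemma rotate_up_down [simp]:
  assumes "n \<in> int_vectors p"
  shows "rotate_up p (rotate_down p n) = n"
proof
  fix i
  show "rotate_up p (rotate_down p n) i = n i"
    using assms by (auto simp: rotate_up_def rotate_down_def int_vectors_def PiE_def extensional_def)
qed

lemma rotate_down_up [simp]:
  assumes "n \<in> int_vectors p"
  shows "rotate_down p (rotate_up p n) = n"
proof
  fix i
  show "rotate_down p (rotate_up p n) i = n i"
    using assms by (auto simp: rotate_up_def rotate_down_def int_vectors_def PiE_def extensional_def)
qed

lemma bij_betw_rotate_up: "bij_betw (rotate_up p) (int_vectors p) (int_vectors p)"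
  by (rule bij_betwI[of _ _ _ "rotate_down p"]) auto

lemma vsum_rotate_up:
  assumes "p > 0"
  shows "vsum p (rotate_up p n) = vsum p n + 1"
proof -
  obtain r where r: "p = Suc r" using assms by (cases p) auto
  have "vsum p (rotate_up p n) = (n r + 1) + (\<Sum>i<r. n i)"
    unfolding vsum_def r by (subst sum.lessThan_Suc_shift) (simp add: rotate_up_def)
  thus ?thesis by (simp add: vsum_def r)
qed

text \<open>Every coordinate raises the weight by its own value: moving from place \<open>i\<close>
  to \<open>i + 1\<close> does so directly, and at the wrap-around it follows from
  \<open>tri (n + 1) = tri n + n\<close>.\<close>

lemma vweight_rotate_up:
  assumes "p > 0"
  shows "vweight p (rotate_up p n) = vweight p n + vsum p n"
proof -
  obtain r where r: "p = Suc r" using assms by (cases p) auto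
  have "vweight p (rotate_up p n) = int p * tri (n r + 1) + (\<Sum>i<r. int p * tri (n i) + (int i + 1) * n i)"
    unfolding vweight_def r by (subst sum.lessThan_Suc_shift) (simp add: rotate_up_def add_ac)
  also have "\<dots> = int p * tri (n r) + int p * n r + (\<Sum>i<r. int p * tri (n i) + int i * n i) + (\<Sum>i<r. n i)"
    by (simp add: tri_add algebra_simps sum.distrib)
  also have "\<dots> = vweight p n + vsum p n"
    by (simp add: vweight_def vsum_def r algebra_simps)
  finally show ?thesis .
qed

lemma power_int_sum:
  fixes a :: "'a :: field"
  assumes "a \<noteq> 0"
  shows "a powi (\<Sum>i\<in>I. f i) = (\<Prod>i\<in>I. a powi f i)"
  using assms by (induction I rule: infinite_finite_induct) (auto simp: power_int_add)

lemma prod_theta_terms: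
  assumes "Q \<noteq> 0"
  shows "(\<Prod>i<p. theta_term (x i * Q ^ i) (Q ^ p) (n i)) = Q powi vweight p n * (\<Prod>i<p. x i powi n i)"
  using assms
  by (simp add: vweight_def power_int_sum prod.distrib [symmetric] theta_term_def power_int_add
      power_int_mult_distrib power_int_power mult_ac)

lemma norm_power_less_1: "norm (Q :: complex) < 1 \<Longrightarrow> p > 0 \<Longrightarrow> norm (Q ^ p) < 1"
  by (simp add: norm_power power_less_one_iff)

lemma vector_theta_has_sum:
  assumes "norm Q < 1" "Q \<noteq> 0" "p > 0" "\<And>i. i < p \<Longrightarrow> x i \<noteq> 0"
  shows "((\<lambda>n. Q powi vweight p n * (\<Prod>i<p. x i powi n i)) has_sum
           (\<Prod>i<p. theta (x i * Q ^ i) (Q ^ p))) (int_vectors p)"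
proof -
  have "((\<lambda>n. \<Prod>i<p. theta_term (x i * Q ^ i) (Q ^ p) (n i)) has_sum
           (\<Prod>i<p. theta (x i * Q ^ i) (Q ^ p))) (int_vectors p)"
    unfolding int_vectors_def
    using assms by (intro has_sum_prod_PiE theta_has_sum norm_power_less_1) auto
  thus ?thesis by (simp only: prod_theta_terms[OF assms(2)])
qed

definition balanced_vectors :: "nat \<Rightarrow> (nat \<Rightarrow> int) set" where
  "balanced_vectors p = {n \<in> int_vectors p. vsum p n = 0}"

definition core_sum :: "nat \<Rightarrow> complex \<Rightarrow> complex" where
  "core_sum p Q = (\<Sum>\<^sub>\<infinity>n\<in>balanced_vectors p. Q powi vweight p n)"

text \<open>Both factors are multisected. For the second one, \<open>Q ^ p / (z * Q ^ i)\<close> is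
  \<open>Q / z * Q ^ (p - 1 - i)\<close>, so the residues occur in reverse order.\<close>

lemma theta_prod_multisection:
  assumes "norm Q < 1" "Q \<noteq> 0" "z \<noteq> 0" "p > 0"
  shows "(\<Prod>i<p. theta_prod (z * Q ^ i) (Q ^ p)) = theta_prod z Q"
proof -
  have "(\<Prod>i<p. qpoch (Q ^ p / (z * Q ^ i)) (Q ^ p)) = (\<Prod>i<p. qpoch (Q / z * Q ^ (p - Suc i)) (Q ^ p))"
  proof (intro prod.cong refl)
    fix i assume "i \<in> {..<p}"
    hence "Q ^ p = Q ^ Suc i * Q ^ (p - Suc i)"
      by (subst power_add [symmetric]) simp
    thus "qpoch (Q ^ p / (z * Q ^ i)) (Q ^ p) = qpoch (Q / z * Q ^ (p - Suc i)) (Q ^ p)"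
      using assms by (intro arg_cong2[of _ _ _ _ qpoch]) (auto simp: field_simps)
  qed
  also have "\<dots> = qpoch (Q / z) Q"
    unfolding qpoch_multisection[OF assms(1,4), of "Q / z"]
    by (rule prod.nat_diff_reindex)
  finally show ?thesis
    by (simp add: theta_prod_def prod.distrib qpoch_multisection[OF assms(1,4), of z])
qed

lemma theta_eq_theta_prod:
  assumes "norm Q < 1" "Q \<noteq> 0" "w \<noteq> 0"
  shows "theta w Q = euler_phi Q * theta_prod (- w) Q"
  using jacobi_triple_product[of Q "- w"] assms by simp

text \<open>The product of the series \<open>theta (Q ^ i) (Q ^ p)\<close> for \<open>i < p\<close>
  is evaluated twice. Sorting the vectors by their sum gives
  \<open>core_sum p Q * theta 1 Q\<close>; the triple product gives
  \<open>E(Q^p)^p * [-1;Q]\<close>. The nonzero factor \<open>[-1;Q]\<close> cancels.\<close>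

lemma core_sum_eq:
  assumes "norm Q < 1" "Q \<noteq> 0" "p > 0"
  shows "core_sum p Q = euler_phi (Q ^ p) ^ p / euler_phi Q"
proof -
  have 1: "((\<lambda>n. Q powi vweight p n * 1 powi vsum p n) has_sum (\<Prod>i<p. theta (Q ^ i) (Q ^ p))) (int_vectors p)"
    using vector_theta_has_sum[OF assms, of "\<lambda>_. 1"] by simp
  \<comment> \<open>\<open>theta_decomposition\<close> with modulus 1 and \<open>z = 1\<close>: only
    the class \<open>k = 0\<close> occurs, and its coefficient is
    \<open>core_sum p Q\<close>.\<close>
  have "((\<lambda>n. Q powi vweight p n * 1 powi vsum p n) has_sum
      (\<Sum>k<1. (\<Sum>\<^sub>\<infinity>n\<in>{n\<in>int_vectors p. vsum p n = int k}. Q powi vweight p n) * 1 ^ k * theta (1 * 1 ^ 1 * Q ^ k) (Q ^ 1)))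
      (int_vectors p)"
  proof (rule theta_decomposition[where T = "rotate_up p"])
    show "(\<lambda>n. Q powi vweight p n * 1 powi vsum p n) summable_on int_vectors p"
      using 1 by (rule has_sum_imp_summable)
  qed (use assms in \<open>auto simp: bij_betw_rotate_up vsum_rotate_up vweight_rotate_up power_int_add\<close>)
  hence "(\<Prod>i<p. theta (Q ^ i) (Q ^ p)) = core_sum p Q * theta 1 Q"
    using has_sum_unique[OF 1] by (simp add: core_sum_def balanced_vectors_def)
  also have "theta 1 Q = euler_phi Q * theta_prod (-1) Q"
    using assms by (intro theta_eq_theta_prod) auto
  also have "(\<Prod>i<p. theta (Q ^ i) (Q ^ p)) = (\<Prod>i<p. euler_phi (Q ^ p) * theta_prod (-1 * Q ^ i) (Q ^ p))"
  proof (intro prod.cong refl)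
    fix i
    show "theta (Q ^ i) (Q ^ p) = euler_phi (Q ^ p) * theta_prod (-1 * Q ^ i) (Q ^ p)"
      using theta_eq_theta_prod[of "Q ^ p" "Q ^ i"] assms norm_power_less_1 by simp
  qed
  also have "\<dots> = euler_phi (Q ^ p) ^ p * theta_prod (-1) Q"
    using theta_prod_multisection[of Q "-1" p] assms by (simp only: prod.distrib) simp
  finally have "euler_phi (Q ^ p) ^ p * theta_prod (-1) Q = core_sum p Q * euler_phi Q * theta_prod (-1) Q"
    by simp
  moreover have "theta_prod (-1) Q \<noteq> 0"
  proof -
    have "qpoch (-1) Q = 2 * qpoch (- Q) Q"
      using qpoch_rec[OF assms(1), of "-1"] by simp
    moreover have "qpoch (- Q) Q \<noteq> 0"
      using assms by (intro qpoch_nonzero') auto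
    ultimately show ?thesis by (simp add: theta_prod_def)
  qed
  ultimately show ?thesis
    using euler_phi_nonzero[OF assms(1)] by (simp add: field_simps)
qed

section \<open>Vectors with a marked coordinate\<close>

definition marked_vectors :: "nat \<Rightarrow> ((nat \<Rightarrow> int) \<times> nat) set" where
  "marked_vectors p = balanced_vectors p \<times> {..<p}"

fun mark :: "nat \<Rightarrow> (nat \<Rightarrow> int) \<times> nat \<Rightarrow> int" where
  "mark p (n, j) = int p * n j + int j"

text \<open>
  In terms of the numbers \<open>p n_i + i\<close>, the marked one is increased by \<open>p - 1\<close> and all others are
  decreased by 1.
\<close>
fun shift_mark :: "nat \<Rightarrow> (nat \<Rightarrow> int) \<times> nat \<Rightarrow> (nat \<Rightarrow> int) \<times> nat" where
  "shift_mark p (n, j) = (let j' = (if j = 0 then p - 1 else j - 1); n' = rotate_down p n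
     in (n'(j' := n' j' + 1), j'))"

fun unshift_mark :: "nat \<Rightarrow> (nat \<Rightarrow> int) \<times> nat \<Rightarrow> (nat \<Rightarrow> int) \<times> nat" where
  "unshift_mark p (n, j) = (rotate_up p (n(j := n j - 1)), if j = p - 1 then 0 else j + 1)"

lemma int_vectors_upd [simp]: "n \<in> int_vectors p \<Longrightarrow> j < p \<Longrightarrow> n(j := x) \<in> int_vectors p"
  by (auto simp: int_vectors_def PiE_def extensional_def)

lemma vsum_upd:
  assumes "j < p"
  shows "vsum p (n(j := x)) = vsum p n + x - n j"
proof -
  have "vsum p m = m j + (\<Sum>i\<in>{..<p} - {j}. m i)" for m
    unfolding vsum_def using assms by (intro sum.remove) auto
  from this[of "n(j := x)"] this[of n] show ?thesis by simp
qed

lemma vweight_upd_Suc: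
  assumes "j < p"
  shows "vweight p (n(j := n j + 1)) = vweight p n + int p * n j + int j"
proof -
  have "vweight p m = (int p * tri (m j) + int j * m j) + (\<Sum>i\<in>{..<p} - {j}. int p * tri (m i) + int i * m i)" for m
    unfolding vweight_def using assms by (intro sum.remove) auto
  from this[of "n(j := n j + 1)"] this[of n] show ?thesis by (simp add: tri_add algebra_simps)
qed

lemma vsum_rotate_down:
  assumes "p > 0" "n \<in> int_vectors p"
  shows "vsum p (rotate_down p n) = vsum p n - 1"
  using vsum_rotate_up[OF assms(1), of "rotate_down p n"] assms(2) by simp

lemma vweight_rotate_down:
  assumes "p > 0" "n \<in> int_vectors p"
  shows "vweight p (rotate_down p n) = vweight p n - vsum p n + 1"
  using vweight_rotate_up[OF assms(1), of "rotate_down p n"] vsum_rotate_down[OF assms] assms(2) by simp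

lemma bij_betw_shift_mark:
  assumes "p > 0"
  shows "bij_betw (shift_mark p) (marked_vectors p) (marked_vectors p)"
proof (rule bij_betwI[of _ _ _ "unshift_mark p"])
  show "shift_mark p \<in> marked_vectors p \<rightarrow> marked_vectors p"
    using assms by (auto simp: marked_vectors_def balanced_vectors_def Let_def vsum_upd vsum_rotate_down)
  show "unshift_mark p \<in> marked_vectors p \<rightarrow> marked_vectors p"
    using assms by (auto simp: marked_vectors_def balanced_vectors_def vsum_upd vsum_rotate_up)
  show "unshift_mark p (shift_mark p x) = x" if "x \<in> marked_vectors p" for x
    using assms that by (cases x) (auto simp: marked_vectors_def balanced_vectors_def Let_def)
  show "shift_mark p (unshift_mark p x) = x" if "x \<in> marked_vectors p" for x
    using assms that by (cases x) (auto simp: marked_vectors_def balanced_vectors_def Let_def)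
qed

lemma mark_shift_mark:
  assumes "p > 0" "x \<in> marked_vectors p"
  shows "mark p (shift_mark p x) = mark p x + int (p - 1)"
proof -
  obtain n j where x: "x = (n, j)" by (cases x)
  have "j < p" using assms by (simp add: x marked_vectors_def)
  thus ?thesis using assms(1)
    by (cases j) (auto simp: x Let_def rotate_down_def algebra_simps of_nat_diff)
qed

text \<open>\<open>rotate_down\<close> raises the weight of a balanced vector by 1. Raising the
  marked coordinate then adds the lowered mark, \<open>mark p x - 1\<close>. Together with
  \<open>mark_shift_mark\<close> this is \<open>A(Qz) = z^(1-p) A(z)\<close> term by term.\<close>

lemma vweight_shift_mark:
  assumes "p > 0" "x \<in> marked_vectors p"
  shows "vweight p (fst (shift_mark p x)) = vweight p (fst x) + mark p x"
proof -
  obtain n j where x: "x = (n, j)" by (cases x)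
  define j' where "j' = (if j = 0 then p - 1 else j - 1)"
  have nj: "n \<in> int_vectors p" "vsum p n = 0" "j < p" "j' < p"
    using assms by (auto simp: x marked_vectors_def balanced_vectors_def j'_def)
  have "vweight p (fst (shift_mark p x)) = vweight p n + 1 + int p * rotate_down p n j' + int j'"
    using nj assms(1) by (simp add: x Let_def j'_def [symmetric] vweight_upd_Suc vweight_rotate_down)
  also have "\<dots> = vweight p n + mark p x"
    using nj assms(1) by (auto simp: x j'_def rotate_down_def algebra_simps of_nat_diff)
  finally show ?thesis by (simp add: x)
qed

text \<open>The function \<open>A(z)\<close>.\<close>

definition marked_core_sum :: "nat \<Rightarrow> complex \<Rightarrow> complex \<Rightarrow> complex" where
  "marked_core_sum p z Q = (\<Sum>\<^sub>\<infinity>x\<in>marked_vectors p. Q powi vweight p (fst x) * z powi mark p x)"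

lemma core_sum_has_sum:
  assumes "norm Q < 1" "Q \<noteq> 0" "p > 0"
  shows "((\<lambda>n. Q powi vweight p n) has_sum core_sum p Q) (balanced_vectors p)"
proof -
  have "(\<lambda>n. Q powi vweight p n) summable_on int_vectors p"
    using vector_theta_has_sum[OF assms, of "\<lambda>_. 1"] by (auto intro: has_sum_imp_summable)
  hence "(\<lambda>n. Q powi vweight p n) summable_on balanced_vectors p"
    by (rule summable_on_subset_banach) (auto simp: balanced_vectors_def)
  thus ?thesis by (simp add: core_sum_def)
qed

text \<open>For a fixed marked place \<open>j\<close>, the terms come from a product of theta series
  with \<open>x j = z ^ p\<close> and all other \<open>x i = 1\<close>, restricted to sum 0. There
  are only \<open>p\<close> places.\<close>

lemma marked_core_sum_has_sum:
  assumes "norm Q < 1" "Q \<noteq> 0" "p > 0" "z \<noteq> 0"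
  shows "((\<lambda>x. Q powi vweight p (fst x) * z powi mark p x) has_sum marked_core_sum p z Q) (marked_vectors p)"
proof -
  have "(\<lambda>n. Q powi vweight p n * z powi mark p (n, j)) summable_on balanced_vectors p" if j: "j < p" for j
  proof -
    have *: "(\<Prod>i<p. (if i = j then z ^ p else 1) powi n i) = z powi (int p * n j)" for n
    proof -
      have "(\<Prod>i<p. (if i = j then z ^ p else 1) powi n i) = (\<Prod>i<p. if i = j then z powi (int p * n i) else 1)"
        by (intro prod.cong) (auto simp: power_int_power)
      thus ?thesis using j by simp
    qed
    have "(\<lambda>n. Q powi vweight p n * z powi (int p * n j)) summable_on int_vectors p"
      by (rule has_sum_imp_summable,
          rule vector_theta_has_sum[OF assms(1-3), of "\<lambda>i. if i = j then z ^ p else 1", unfolded *])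
         (use assms(4) in simp)
    hence "(\<lambda>n. Q powi vweight p n * z powi (int p * n j) * z ^ j) summable_on balanced_vectors p"
      by (intro summable_on_cmult_left, rule summable_on_subset_banach) (auto simp: balanced_vectors_def)
    thus ?thesis using assms(4) by (simp add: power_int_add mult_ac)
  qed
  hence "(\<lambda>(j, n). Q powi vweight p n * z powi mark p (n, j)) abs_summable_on ({..<p} \<times> balanced_vectors p)"
    unfolding abs_summable_on_Sigma_iff
    by (auto simp flip: summable_on_iff_abs_summable_on_complex)
  hence "(\<lambda>(j, n). Q powi vweight p n * z powi mark p (n, j)) summable_on ({..<p} \<times> balanced_vectors p)"
    by (simp add: summable_on_iff_abs_summable_on_complex)
  hence "(\<lambda>x. Q powi vweight p (fst x) * z powi mark p x) summable_on marked_vectors p"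
    unfolding marked_vectors_def by (subst summable_on_swap) (simp add: case_prod_unfold)
  thus ?thesis by (simp add: marked_core_sum_def)
qed

text \<open>At a \<open>p\<close>-th root of unity, \<open>z powi (p * n j)\<close> is 1, so the sum
  over the marked place separates from the sum over the vectors.\<close>

lemma marked_core_sum_eq_sum:
  assumes "norm Q < 1" "Q \<noteq> 0" "p > 0" "z ^ p = 1"
  shows "marked_core_sum p z Q = core_sum p Q * (\<Sum>j<p. z ^ j)"
proof -
  have z: "z \<noteq> 0" using assms by (auto simp: power_0_left)
  have "((\<lambda>(n, j). Q powi vweight p n * z ^ j) has_sum (core_sum p Q * (\<Sum>j<p. z ^ j))) (balanced_vectors p \<times> {..<p})"
    using assms by (intro has_sum_times core_sum_has_sum has_sum_finite) auto
  also have "?this \<longleftrightarrow> ((\<lambda>x. Q powi vweight p (fst x) * z powi mark p x) has_sum (core_sum p Q * (\<Sum>j<p. z ^ j))) (marked_vectors p)"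
    unfolding marked_vectors_def
  proof (intro has_sum_cong, clarify)
    fix n :: "nat \<Rightarrow> int" and j
    have "z powi mark p (n, j) = (z ^ p) powi n j * z ^ j"
      using z by (simp add: power_int_add power_int_power)
    thus "Q powi vweight p n * z ^ j = Q powi vweight p (fst (n, j)) * z powi mark p (n, j)"
      using assms by simp
  qed
  finally show ?thesis
    using has_sum_unique marked_core_sum_has_sum[OF assms(1-3) z] by blast
qed

lemma theta_prod_neq_0:
  assumes "norm Q < 1" "Q \<noteq> 0" "0 < k" "k < p"
  shows "theta_prod (Q ^ k) (Q ^ p) \<noteq> 0"
proof -
  have "Q ^ p / Q ^ k = Q ^ (p - k)"
    using assms by (simp add: power_diff)
  moreover have "qpoch (Q ^ i) (Q ^ p) \<noteq> 0" if "i > 0" for i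
    using that assms norm_power_less_1[OF assms(1)] by (intro qpoch_nonzero') auto
  ultimately show ?thesis unfolding theta_prod_def using assms by simp
qed

text \<open>The product \<open>A(z) * theta (- z) Q\<close> is quasi-periodic and hence a
  combination of \<open>p\<close> theta functions in \<open>z ^ p\<close>. It vanishes at all
  \<open>p\<close>-th roots of unity: at 1 because of the theta factor, at the others because of
  \<open>A\<close>. This leaves only the class \<open>k = 0\<close>.\<close>

lemma marked_core_sum_theta:
  assumes Q: "norm Q < 1" "Q \<noteq> 0" and p: "p > 0"
  obtains c where "\<And>z. z \<noteq> 0 \<Longrightarrow> marked_core_sum p z Q * theta (- z) Q = c * theta (- (z ^ p)) (Q ^ p)"
proof -
  define Y where "Y = marked_vectors p \<times> (UNIV :: int set)"
  define K where "K = (\<lambda>(x, l). mark p x + l)"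
  define W where "W = (\<lambda>(x :: (nat \<Rightarrow> int) \<times> nat, l). Q powi vweight p (fst x) * theta_term (-1) Q l)"
  \<comment> \<open>The mark grows by \<open>p - 1\<close> and \<open>l\<close> by 1, so
    \<open>K\<close> grows by \<open>p\<close> in total.\<close>
  define T where "T = (\<lambda>(x, l). (shift_mark p x, l + (1 :: int)))"
  define b where "b = (\<lambda>k. \<Sum>\<^sub>\<infinity>y\<in>{y\<in>Y. K y = k}. W y)"
  have expansion: "marked_core_sum p z Q * theta (- z) Q = (\<Sum>k<p. b (int k) * z ^ k * theta (- (z ^ p) * Q ^ k) (Q ^ p))"
    if z: "z \<noteq> 0" for z
  proof -
    have "((\<lambda>(x, l). (Q powi vweight p (fst x) * z powi mark p x) * theta_term (- z) Q l) has_sum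
        (marked_core_sum p z Q * theta (- z) Q)) Y"
      unfolding Y_def using Q p z by (intro has_sum_times marked_core_sum_has_sum theta_has_sum) auto
    also have "(\<lambda>(x, l). (Q powi vweight p (fst x) * z powi mark p x) * theta_term (- z) Q l) = (\<lambda>y. W y * z powi K y)"
    proof
      fix y :: "((nat \<Rightarrow> int) \<times> nat) \<times> int"
      obtain x l where y: "y = (x, l)" by (cases y)
      have "theta_term (- z) Q l = theta_term (-1) Q l * z powi l"
        using power_int_mult_distrib[of "-1" z l] by (simp add: theta_term_def)
      thus "(case y of (x, l) \<Rightarrow> (Q powi vweight p (fst x) * z powi mark p x) * theta_term (- z) Q l) = W y * z powi K y"
        using z by (simp add: y W_def K_def power_int_add)
    qed
    finally have 1: "((\<lambda>y. W y * z powi K y) has_sum (marked_core_sum p z Q * theta (- z) Q)) Y" .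
    have "((\<lambda>y. W y * z powi K y) has_sum (\<Sum>k<p. b (int k) * z ^ k * theta (-1 * z ^ p * Q ^ k) (Q ^ p))) Y"
      unfolding b_def
    proof (rule theta_decomposition[where T = T])
      have "bij_betw (\<lambda>l. l + 1) UNIV (UNIV :: int set)"
        by (rule bij_betwI[of _ _ _ "\<lambda>l. l - 1"]) auto
      hence "bij_betw (map_prod (shift_mark p) (\<lambda>l. l + 1)) Y Y"
        unfolding Y_def by (intro bij_betw_map_prod bij_betw_shift_mark p)
      thus "bij_betw T Y Y" by (simp add: T_def map_prod_def)
      show "(\<lambda>y. W y * z powi K y) summable_on Y"
        using 1 by (rule has_sum_imp_summable)
      fix y assume "y \<in> Y"
      then obtain x l where y: "y = (x, l)" "x \<in> marked_vectors p"
        by (auto simp: Y_def)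
      show "K (T y) = K y + int p"
        using p y by (simp add: K_def T_def mark_shift_mark)
      show "W (T y) = -1 * Q powi K y * W y"
        using p Q y by (simp add: K_def T_def W_def vweight_shift_mark theta_term_Suc power_int_add)
    qed (use Q p z in auto)
    thus ?thesis using has_sum_unique[OF 1] by simp
  qed
  define d where "d = (\<lambda>k. b (int k) * theta (- (Q ^ k)) (Q ^ p))"
  \<comment> \<open>\<open>d 0, \<dots>, d (p - 1)\<close> are the coefficients of a polynomial of degree below \<open>p\<close> with \<open>p\<close> roots.\<close>
  have root: "(\<Sum>k\<le>p - 1. d k * z ^ k) = 0" if z: "z ^ p = 1" for z
  proof -
    have z0: "z \<noteq> 0" using z p by (auto simp: power_0_left)
    have "marked_core_sum p z Q * theta (- z) Q = 0"
    proof (cases "z = 1")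
      case True
      have "theta_prod 1 Q = 0"
        using qpoch_rec[OF Q(1), of 1] by (simp add: theta_prod_def)
      thus ?thesis using True jacobi_triple_product[OF Q, of 1] by simp
    next
      case False
      hence "(\<Sum>j<p. z ^ j) = 0"
        using z by (simp add: sum_gp_strict)
      thus ?thesis using marked_core_sum_eq_sum[OF Q p z] by simp
    qed
    \<comment> \<open>As \<open>z ^ p = 1\<close>, the theta factors no longer depend on
      \<open>z\<close> and go into the constants \<open>d k\<close>.\<close>
    hence "(\<Sum>k<p. d k * z ^ k) = 0"
      unfolding expansion[OF z0] by (simp add: d_def z mult_ac)
    moreover have "{..<p} = {..p - 1}" using p by auto
    ultimately show ?thesis by simp
  qed
  have d0: "d k = 0" if "k < p" for k
  proof (rule ccontr)
    assume "d k \<noteq> 0"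
    hence fin: "finite {z. (\<Sum>k\<le>p - 1. d k * z ^ k) = 0}" and card: "card {z. (\<Sum>k\<le>p - 1. d k * z ^ k) = 0} \<le> p - 1"
      using polyfun_rootbound[of d k "p - 1"] that by auto
    have "p = card {z :: complex. z ^ p = 1}"
      using card_roots_unity_eq[OF p] by simp
    also have "\<dots> \<le> card {z. (\<Sum>k\<le>p - 1. d k * z ^ k) = 0}"
      using root by (intro card_mono fin) auto
    finally show False using card p by linarith
  qed
  \<comment> \<open>For \<open>0 < k < p\<close> the theta factor of \<open>d k\<close> is nonzero,
    so \<open>b\<close> must vanish. For \<open>k = 0\<close> that factor is itself 0, and
    \<open>b 0\<close> survives.\<close>
  have b0: "b (int k) = 0" if "0 < k" "k < p" for k
  proof -
    have "theta (- (Q ^ k)) (Q ^ p) = euler_phi (Q ^ p) * theta_prod (Q ^ k) (Q ^ p)"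
      using Q p norm_power_less_1 by (intro jacobi_triple_product) auto
    hence "theta (- (Q ^ k)) (Q ^ p) \<noteq> 0"
      using theta_prod_neq_0[OF Q that] euler_phi_nonzero[of "Q ^ p"] norm_power_less_1[OF Q(1) p] by simp
    thus ?thesis using d0[OF that(2)] by (simp add: d_def)
  qed
  have "marked_core_sum p z Q * theta (- z) Q = b 0 * theta (- (z ^ p)) (Q ^ p)" if z: "z \<noteq> 0" for z
  proof -
    have "(\<Sum>k<p. b (int k) * z ^ k * theta (- (z ^ p) * Q ^ k) (Q ^ p)) =
        (\<Sum>k\<in>{0}. b (int k) * z ^ k * theta (- (z ^ p) * Q ^ k) (Q ^ p))"
      using p b0 by (intro sum.mono_neutral_right) auto
    thus ?thesis using expansion[OF z] by simp
  qed
  thus ?thesis by (rule that)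
qed

lemma tendsto_theta:
  assumes "norm Q < 1" "Q \<noteq> 0" "w \<noteq> 0" "(f \<longlongrightarrow> w) F"
  shows "((\<lambda>x. theta (f x) Q) \<longlongrightarrow> theta w Q) F"
proof -
  have ev: "eventually (\<lambda>x. f x \<noteq> 0) F"
    using tendsto_imp_eventually_ne[OF assms(4,3)] .
  have "((\<lambda>x. euler_phi Q * theta_prod (- f x) Q) \<longlongrightarrow> euler_phi Q * theta_prod (- w) Q) F"
    unfolding theta_prod_def using assms by (intro tendsto_intros tendsto_qpoch) auto
  also have "euler_phi Q * theta_prod (- w) Q = theta w Q"
    using theta_eq_theta_prod[OF assms(1-3)] by simp
  finally show ?thesis
    by (rule Lim_transform_eventually) (use ev in eventually_elim, use theta_eq_theta_prod[OF assms(1,2)] in auto)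
qed

text \<open>With \<open>shift_mark\<close> as the symmetry, \<open>theta_decomposition\<close>
  writes \<open>A\<close> as a finite combination of \<open>p - 1\<close> theta functions, whose
  continuity is known.\<close>

lemma tendsto_marked_core_sum:
  assumes Q: "norm Q < 1" "Q \<noteq> 0" and p: "p > 1"
  shows "(\<lambda>z. marked_core_sum p z Q) \<midarrow>1\<rightarrow> marked_core_sum p 1 Q"
proof -
  define b where "b = (\<lambda>k. \<Sum>\<^sub>\<infinity>x\<in>{x\<in>marked_vectors p. mark p x = k}. Q powi vweight p (fst x))"
  have expansion: "marked_core_sum p z Q = (\<Sum>k<p-1. b (int k) * z ^ k * theta (1 * z ^ (p-1) * Q ^ k) (Q ^ (p-1)))"
    if z: "z \<noteq> 0" for z
  proof -
    have 1: "((\<lambda>x. Q powi vweight p (fst x) * z powi mark p x) has_sum marked_core_sum p z Q) (marked_vectors p)"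
      using Q p z by (intro marked_core_sum_has_sum) auto
    have "((\<lambda>x. Q powi vweight p (fst x) * z powi mark p x) has_sum
      (\<Sum>k<p-1. b (int k) * z ^ k * theta (1 * z ^ (p-1) * Q ^ k) (Q ^ (p-1)))) (marked_vectors p)"
      unfolding b_def
    proof (rule theta_decomposition[where T = "shift_mark p"])
      show "(\<lambda>x. Q powi vweight p (fst x) * z powi mark p x) summable_on marked_vectors p"
        using 1 by (rule has_sum_imp_summable)
    qed (use Q p z in \<open>auto simp: bij_betw_shift_mark mark_shift_mark vweight_shift_mark power_int_add\<close>)
    thus ?thesis using has_sum_unique[OF 1] by simp
  qed
  have "(\<lambda>z. \<Sum>k<p-1. b (int k) * z ^ k * theta (1 * z ^ (p-1) * Q ^ k) (Q ^ (p-1))) \<midarrow>1\<rightarrow>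
      (\<Sum>k<p-1. b (int k) * 1 ^ k * theta (1 * 1 ^ (p-1) * Q ^ k) (Q ^ (p-1)))"
    using Q p by (intro tendsto_intros tendsto_theta norm_power_less_1) auto
  also have "(\<Sum>k<p-1. b (int k) * 1 ^ k * theta (1 * 1 ^ (p-1) * Q ^ k) (Q ^ (p-1))) = marked_core_sum p 1 Q"
    by (rule expansion [symmetric]) auto
  finally show ?thesis
  proof (rule Lim_transform_eventually)
    have "eventually (\<lambda>z::complex. z \<noteq> 0) (at 1)"
      by (rule eventually_neq_at_within)
    thus "eventually (\<lambda>z. (\<Sum>k<p-1. b (int k) * z ^ k * theta (1 * z ^ (p-1) * Q ^ k) (Q ^ (p-1))) = marked_core_sum p z Q) (at 1)"
      by eventually_elim (rule expansion [symmetric])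
  qed
qed

text \<open>\<open>marked_core_sum_theta\<close> gives the identity up to a constant
  \<open>c\<close>. Comparing both sides at the common zero \<open>z = 1\<close>, where
  \<open>A(1) = p * core_sum p Q\<close>, determines \<open>c\<close>.\<close>

theorem marked_core_sum_identity:
  assumes Q: "norm Q < 1" "Q \<noteq> 0" and p: "p > 1" and z: "z \<noteq> 0"
  shows "marked_core_sum p z Q * theta_prod z Q * euler_phi (Q ^ p) ^ 2 =
    core_sum p Q * euler_phi Q ^ 2 * theta_prod (z ^ p) (Q ^ p)"
proof -
  have p0: "p > 0" using p by simp
  have Qp: "norm (Q ^ p) < 1" "Q ^ p \<noteq> 0"
    using Q p0 norm_power_less_1 by auto
  obtain c where c: "\<And>z. z \<noteq> 0 \<Longrightarrow> marked_core_sum p z Q * theta (- z) Q = c * theta (- (z ^ p)) (Q ^ p)"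
    using marked_core_sum_theta[OF Q p0] by blast
  have c': "marked_core_sum p z Q * euler_phi Q * theta_prod z Q = c * euler_phi (Q ^ p) * theta_prod (z ^ p) (Q ^ p)"
    if "z \<noteq> 0" for z
    using c[OF that] jacobi_triple_product[OF Q that] jacobi_triple_product[OF Qp, of "z ^ p"] that
    by (simp add: mult_ac)
  \<comment> \<open>\<open>f\<close> and \<open>g\<close> are the two sides of \<open>c'\<close>
    divided by \<open>1 - z\<close>. They agree away from 0 and 1, so their limits at 1
    agree.\<close>
  define f where "f = (\<lambda>z. marked_core_sum p z Q * euler_phi Q * (qpoch (z * Q) Q * qpoch (Q / z) Q))"
  define g where "g = (\<lambda>z. c * euler_phi (Q ^ p) * ((\<Sum>i<p. z ^ i) * qpoch (z ^ p * Q ^ p) (Q ^ p) * qpoch (Q ^ p / z ^ p) (Q ^ p)))"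
  have fg: "f z = g z" if "z \<noteq> 0" "z \<noteq> 1" for z
  proof -
    have "(1 - z) * f z = marked_core_sum p z Q * euler_phi Q * theta_prod z Q"
      using qpoch_rec[OF Q(1), of z] by (simp add: f_def theta_prod_def)
    also have "\<dots> = c * euler_phi (Q ^ p) * theta_prod (z ^ p) (Q ^ p)"
      by (rule c'[OF that(1)])
    also have "\<dots> = c * euler_phi (Q ^ p) * ((1 - z ^ p) * qpoch (z ^ p * Q ^ p) (Q ^ p) * qpoch (Q ^ p / z ^ p) (Q ^ p))"
      using qpoch_rec[OF Qp(1), of "z ^ p"] by (simp add: theta_prod_def)
    also have "1 - z ^ p = (1 - z) * (\<Sum>i<p. z ^ i)"
      by (rule one_diff_power_eq)
    also have "c * euler_phi (Q ^ p) * ((1 - z) * (\<Sum>i<p. z ^ i) * qpoch (z ^ p * Q ^ p) (Q ^ p) * qpoch (Q ^ p / z ^ p) (Q ^ p)) = (1 - z) * g z"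
      by (simp add: g_def)
    finally show ?thesis using that by simp
  qed
  have "f \<midarrow>1\<rightarrow> marked_core_sum p 1 Q * euler_phi Q * (qpoch (1 * Q) Q * qpoch (Q / 1) Q)"
    unfolding f_def by (intro tendsto_intros tendsto_marked_core_sum tendsto_qpoch Q p) auto
  also have "marked_core_sum p 1 Q = core_sum p Q * of_nat p"
    using marked_core_sum_eq_sum[OF Q p0, of 1] by simp
  finally have f1: "f \<midarrow>1\<rightarrow> core_sum p Q * of_nat p * euler_phi Q ^ 3"
    by (simp add: euler_phi_def power3_eq_cube mult_ac)
  have "g \<midarrow>1\<rightarrow> c * euler_phi (Q ^ p) * ((\<Sum>i<p. 1 ^ i) * qpoch (1 ^ p * Q ^ p) (Q ^ p) * qpoch (Q ^ p / 1 ^ p) (Q ^ p))"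
    unfolding g_def by (intro tendsto_intros tendsto_qpoch Qp) auto
  hence g1: "g \<midarrow>1\<rightarrow> c * of_nat p * euler_phi (Q ^ p) ^ 3"
    by (simp add: euler_phi_def power3_eq_cube mult_ac)
  have "eventually (\<lambda>z. f z = g z) (at 1)"
  proof -
    have "eventually (\<lambda>z::complex. z \<noteq> 0) (at 1)"
      by (rule eventually_neq_at_within)
    moreover have "eventually (\<lambda>z::complex. z \<noteq> 1) (at 1)"
      by (rule eventually_neq_at_within)
    ultimately show ?thesis by eventually_elim (rule fg)
  qed
  from Lim_transform_eventually[OF f1 this] g1
  have "core_sum p Q * of_nat p * euler_phi Q ^ 3 = c * of_nat p * euler_phi (Q ^ p) ^ 3"
    by (rule LIM_unique)
  hence cc: "core_sum p Q * euler_phi Q ^ 3 = c * euler_phi (Q ^ p) ^ 3"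
    using p by simp
  have "(marked_core_sum p z Q * theta_prod z Q * euler_phi (Q ^ p) ^ 2) * euler_phi Q =
      (marked_core_sum p z Q * euler_phi Q * theta_prod z Q) * euler_phi (Q ^ p) ^ 2"
    by simp
  also have "\<dots> = (c * euler_phi (Q ^ p) ^ 3) * theta_prod (z ^ p) (Q ^ p)"
    unfolding c'[OF z] by (simp add: power2_eq_square power3_eq_cube)
  also have "\<dots> = (core_sum p Q * euler_phi Q ^ 2 * theta_prod (z ^ p) (Q ^ p)) * euler_phi Q"
    unfolding cc [symmetric] by (simp add: power2_eq_square power3_eq_cube)
  finally show ?thesis using euler_phi_nonzero[OF Q(1)] by simp
qed

section \<open>Power series with nonnegative coefficients\<close>

text \<open>Natural coefficients encode integrality and nonnegativity at once. The point
  \<open>q = 0\<close> is left out because the theta series contain negative powers.\<close>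

definition nonneg_power_series :: "(complex \<Rightarrow> complex) \<Rightarrow> bool" where
  "nonneg_power_series f \<longleftrightarrow>
     (\<exists>a :: nat \<Rightarrow> nat. \<forall>q. q \<noteq> 0 \<longrightarrow> norm q < 1 \<longrightarrow> (\<lambda>n. of_nat (a n) * q ^ n) sums f q)"

lemma nonneg_power_series_cong:
  assumes "nonneg_power_series f" "\<And>q. q \<noteq> 0 \<Longrightarrow> norm q < 1 \<Longrightarrow> f q = g q"
  shows "nonneg_power_series g"
  using assms unfolding nonneg_power_series_def by force

lemma nonneg_power_series_1: "nonneg_power_series (\<lambda>_. 1)"
  unfolding nonneg_power_series_def
proof (intro exI[of _ "\<lambda>n. if n = 0 then 1 else 0"] allI impI)
  fix q :: complex
  have "(\<lambda>n. if n = 0 then q ^ n else 0) sums (q ^ 0)"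
    by (rule sums_single)
  thus "(\<lambda>n. of_nat (if n = 0 then 1 else 0) * q ^ n) sums 1"
    by (simp add: if_distrib if_distribR cong: if_cong)
qed

lemma nonneg_power_series_mult:
  assumes "nonneg_power_series f" "nonneg_power_series g"
  shows "nonneg_power_series (\<lambda>q. f q * g q)"
proof -
  obtain a where a: "\<And>q. q \<noteq> 0 \<Longrightarrow> norm q < 1 \<Longrightarrow> (\<lambda>n. of_nat (a n) * q ^ n) sums f q"
    using assms(1) by (auto simp: nonneg_power_series_def)
  obtain b where b: "\<And>q. q \<noteq> 0 \<Longrightarrow> norm q < 1 \<Longrightarrow> (\<lambda>n. of_nat (b n) * q ^ n) sums g q"
    using assms(2) by (auto simp: nonneg_power_series_def)
  \<comment> \<open>With nonnegative coefficients, absolute convergence at \<open>q\<close> is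
    convergence at the real point \<open>norm q\<close>.\<close>
  have abs_conv: "summable (\<lambda>n. norm (of_nat (c n) * q ^ n))"
    if c: "\<And>q. q \<noteq> 0 \<Longrightarrow> norm q < 1 \<Longrightarrow> (\<lambda>n. of_nat (c n) * q ^ n) sums h q"
      and q: "q \<noteq> 0" "norm q < 1" for c :: "nat \<Rightarrow> nat" and h :: "complex \<Rightarrow> complex" and q :: complex
  proof -
    have "(\<lambda>n. of_nat (c n) * complex_of_real (norm q) ^ n) sums h (of_real (norm q))"
      using q by (intro c) auto
    hence "summable (\<lambda>n. complex_of_real (real (c n) * norm q ^ n))"
      by (simp add: sums_iff)
    hence "summable (\<lambda>n. real (c n) * norm q ^ n)"
      by (simp only: summable_of_real_iff)
    thus ?thesis by (simp add: norm_mult norm_power)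
  qed
  show ?thesis unfolding nonneg_power_series_def
  proof (intro exI[of _ "\<lambda>n. \<Sum>i\<le>n. a i * b (n - i)"] allI impI)
    fix q :: complex assume q: "q \<noteq> 0" "norm q < 1"
    have "(\<lambda>n. \<Sum>i\<le>n. (of_nat (a i) * q ^ i) * (of_nat (b (n - i)) * q ^ (n - i))) sums
        ((\<Sum>n. of_nat (a n) * q ^ n) * (\<Sum>n. of_nat (b n) * q ^ n))"
      by (intro Cauchy_product_sums abs_conv[of a f] abs_conv[of b g] a b q)
    also have "(\<lambda>n. \<Sum>i\<le>n. (of_nat (a i) * q ^ i) * (of_nat (b (n - i)) * q ^ (n - i))) =
        (\<lambda>n. of_nat (\<Sum>i\<le>n. a i * b (n - i)) * q ^ n)"
    proof
      fix n
      have "(of_nat (a i) * q ^ i) * (of_nat (b (n - i)) * q ^ (n - i)) = of_nat (a i * b (n - i)) * q ^ n"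
        if "i \<le> n" for i
      proof -
        have "q ^ n = q ^ i * q ^ (n - i)" using that by (simp flip: power_add)
        thus ?thesis by (simp add: mult_ac)
      qed
      thus "(\<Sum>i\<le>n. (of_nat (a i) * q ^ i) * (of_nat (b (n - i)) * q ^ (n - i))) =
          of_nat (\<Sum>i\<le>n. a i * b (n - i)) * q ^ n"
        unfolding of_nat_sum sum_distrib_right by (intro sum.cong) auto
    qed
    also have "(\<Sum>n. of_nat (a n) * q ^ n) * (\<Sum>n. of_nat (b n) * q ^ n) = f q * g q"
      using a[OF q] b[OF q] by (simp add: sums_iff)
    finally show "(\<lambda>n. of_nat (\<Sum>i\<le>n. a i * b (n - i)) * q ^ n) sums (f q * g q)" .
  qed
qed

lemma nonneg_power_series_prod:
  assumes "\<And>i. i \<in> I \<Longrightarrow> nonneg_power_series (f i)"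
  shows "nonneg_power_series (\<lambda>q. \<Prod>i\<in>I. f i q)"
  using assms
  by (induction I rule: infinite_finite_induct)
     (auto simp: nonneg_power_series_1 intro: nonneg_power_series_mult)

lemma nonneg_power_series_power:
  assumes "nonneg_power_series f"
  shows "nonneg_power_series (\<lambda>q. f q ^ n)"
  using nonneg_power_series_prod[of "{..<n}" "\<lambda>_. f"] assms by simp

text \<open>The coefficient of \<open>q ^ n\<close> counts the \<open>x\<close> with
  \<open>e x = n\<close>. Their number is finite, since otherwise infinitely many equal terms would
  be summable at \<open>q = 1/2\<close>.\<close>

lemma nonneg_power_series_has_sum:
  fixes e :: "'a \<Rightarrow> nat"
  assumes "\<And>q. q \<noteq> 0 \<Longrightarrow> norm q < 1 \<Longrightarrow> ((\<lambda>x. q ^ e x) has_sum f q) X"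
  shows "nonneg_power_series f"
proof -
  have fin: "finite {x\<in>X. e x = n}" for n
  proof (rule ccontr)
    assume inf: "infinite {x\<in>X. e x = n}"
    have "(\<lambda>x. (1 / 2 :: complex) ^ e x) summable_on X"
      using assms[of "1/2"] by (intro has_sum_imp_summable) auto
    hence "(\<lambda>x. (1 / 2 :: real) ^ e x) summable_on X"
      by (simp add: summable_on_iff_abs_summable_on_complex norm_power norm_divide)
    hence "(\<lambda>x. (1 / 2 :: real) ^ e x) summable_on {x\<in>X. e x = n}"
      by (rule summable_on_subset_banach) auto
    also have "?this \<longleftrightarrow> (\<lambda>x. (1 / 2 :: real) ^ n) summable_on {x\<in>X. e x = n}"
      by (intro summable_on_cong) auto
    finally show False
      using infsum_diverge_constant[OF inf, of "(1/2::real) ^ n"] by simp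
  qed
  show ?thesis unfolding nonneg_power_series_def
  proof (intro exI[of _ "\<lambda>n. card {x\<in>X. e x = n}"] allI impI)
    fix q :: complex assume q: "q \<noteq> 0" "norm q < 1"
    have "((\<lambda>(n, x). q ^ n) has_sum f q) (SIGMA n:UNIV. {x\<in>X. e x = n})"
      using assms[OF q] by (subst has_sum_reindex_bij_witness[of _ "\<lambda>x. (e x, x)" snd X "\<lambda>x. q ^ e x"]) auto
    hence "((\<lambda>n. of_nat (card {x\<in>X. e x = n}) * q ^ n) has_sum f q) UNIV"
    proof (rule has_sum_SigmaD)
      fix n
      show "((\<lambda>x. case (n, x) of (n, x) \<Rightarrow> q ^ n) has_sum of_nat (card {x\<in>X. e x = n}) * q ^ n) {x\<in>X. e x = n}"
        using fin[of n] by (intro has_sum_finiteI) auto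
    qed
    thus "(\<lambda>n. of_nat (card {x\<in>X. e x = n}) * q ^ n) sums f q"
      by (rule has_sum_imp_sums)
  qed
qed

text \<open>Each summand is nonnegative. For \<open>n i < 0\<close>, reflection by
  \<open>tri_minus\<close> turns it into \<open>p * tri (- n i) + (p - i) * (- n i)\<close>, where
  \<open>i < p\<close>.\<close>

lemma vweight_nonneg: "vweight p n \<ge> 0"
  unfolding vweight_def
proof (rule sum_nonneg)
  fix i assume i: "i \<in> {..<p}"
  show "0 \<le> int p * tri (n i) + int i * n i"
  proof (cases "n i \<ge> 0")
    case True
    thus ?thesis by (simp add: tri_nonneg)
  next
    case False
    have "tri (n i) = tri (- n i) - n i"
      using tri_minus[of "n i"] by simp
    hence "int p * tri (n i) + int i * n i = int p * tri (- n i) + (int p - int i) * (- n i)"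
      by (simp only:) (simp add: algebra_simps)
    moreover have "(int p - int i) * (- n i) \<ge> 0"
      using i False by (intro mult_nonneg_nonneg) auto
    moreover have "int p * tri (- n i) \<ge> 0" by (simp add: tri_nonneg)
    ultimately show ?thesis by linarith
  qed
qed

lemma power_pos_less_1:
  fixes q :: complex
  assumes "q \<noteq> 0" "norm q < 1" "m > 0"
  shows "norm (q ^ m) < 1" "q ^ m \<noteq> 0"
  using assms norm_power_less_1 by auto

lemma nonneg_core_sum:
  assumes "p > 0" "m > 0"
  shows "nonneg_power_series (\<lambda>q. core_sum p (q ^ m))"
proof (rule nonneg_power_series_has_sum)
  fix q :: complex assume q: "q \<noteq> 0" "norm q < 1"
  have "(q ^ m) powi vweight p n = q ^ (m * nat (vweight p n))" for n
    using vweight_nonneg[of p n] by (simp add: power_int_nonneg_exp power_mult)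
  thus "((\<lambda>n. q ^ (m * nat (vweight p n))) has_sum core_sum p (q ^ m)) (balanced_vectors p)"
    using core_sum_has_sum[of "q ^ m" p] power_pos_less_1[OF q assms(2)] assms(1) by simp
qed

lemma nonneg_marked_core_sum:
  assumes "p > 0" "a \<le> m" "m > 0"
  shows "nonneg_power_series (\<lambda>q. marked_core_sum p (q ^ a) (q ^ m))"
proof (rule nonneg_power_series_has_sum)
  define e where "e = (\<lambda>x. int m * vweight p (fst x) + int a * mark p x)"
  fix q :: complex assume q: "q \<noteq> 0" "norm q < 1"
  have "((\<lambda>x. (q ^ m) powi vweight p (fst x) * (q ^ a) powi mark p x) has_sum marked_core_sum p (q ^ a) (q ^ m)) (marked_vectors p)"
    using power_pos_less_1[OF q assms(3)] q assms(1) by (intro marked_core_sum_has_sum) auto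
  also have "?this \<longleftrightarrow> ((\<lambda>x. q ^ nat (e x)) has_sum marked_core_sum p (q ^ a) (q ^ m)) (marked_vectors p)"
  proof (rule has_sum_cong)
    fix x assume x: "x \<in> marked_vectors p"
    \<comment> \<open>\<open>e x\<close> is linear in \<open>a\<close>, and at \<open>a = 0\<close> and \<open>a = m\<close> it is \<open>m\<close> times a weight.\<close>
    have "e x = int (m - a) * vweight p (fst x) + int a * vweight p (fst (shift_mark p x))"
      using assms by (simp add: e_def vweight_shift_mark[OF assms(1) x] of_nat_diff algebra_simps)
    hence "e x \<ge> 0" by (simp add: vweight_nonneg)
    hence "q ^ nat (e x) = q powi e x" by (simp add: power_int_nonneg_exp)
    also have "\<dots> = (q ^ m) powi vweight p (fst x) * (q ^ a) powi mark p x"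
      using q by (simp add: e_def power_int_add power_int_power)
    finally show "(q ^ m) powi vweight p (fst x) * (q ^ a) powi mark p x = q ^ nat (e x)" ..
  qed
  finally show "((\<lambda>x. q ^ nat (int m * vweight p (fst x) + int a * mark p x)) has_sum marked_core_sum p (q ^ a) (q ^ m)) (marked_vectors p)"
    unfolding e_def .
qed

section \<open>Euler products twisted by the Moebius function\<close>

lemma moebius_mu_prime_mult:
  assumes "prime p" "\<not> p dvd d"
  shows "moebius_mu (p * d) = - moebius_mu d"
proof (cases "squarefree d")
  case True
  hence d: "d \<noteq> 0" by (intro notI) simp
  have cop: "coprime p d" using assms by (rule prime_imp_coprime)
  have "squarefree (p * d)"
    using True cop squarefree_prime[OF assms(1)] by (intro squarefree_mult_coprime)
  moreover have "prime_factors (p * d) = insert p (prime_factors d)"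
    using assms d by (simp add: prime_factors_product prime_prime_factors prime_gt_0_nat)
  moreover have "p \<notin> prime_factors d"
    using assms by (simp add: in_prime_factors_iff)
  ultimately show ?thesis using True by (simp add: moebius_mu_def)
next
  case False
  hence "\<not> squarefree (p * d)" using squarefree_multD by blast
  thus ?thesis using False by (simp add: moebius_mu_def)
qed

lemma moebius_mu_prime_square: "prime p \<Longrightarrow> p ^ 2 dvd d \<Longrightarrow> moebius_mu d = 0"
  by (auto simp: moebius_mu_def dest: squarefreeD)

lemma moebius_mu_1 [simp]: "moebius_mu (Suc 0) = 1"
  by (simp add: moebius_mu_def)

text \<open>For a prime \<open>p\<close> dividing \<open>g\<close>, the divisors \<open>d\<close>
  prime to \<open>p\<close> cancel against \<open>p * d\<close>; all other divisors are multiples of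
  \<open>p ^ 2\<close>.\<close>

lemma sum_moebius_mu:
  assumes "g > 0"
  shows "(\<Sum>d | d dvd g. moebius_mu d) = (if g = 1 then 1 else 0)"
proof (cases "g = 1")
  case False
  then obtain p where p: "prime p" "p dvd g" using prime_factor_nat by blast
  let ?A = "{d. d dvd g \<and> \<not> p dvd d}"
  have fin: "finite {d. d dvd g}" using assms by simp
  have "(\<Sum>d | d dvd g. moebius_mu d) = (\<Sum>d\<in>?A \<union> (*) p ` ?A. moebius_mu d)"
  proof (rule sum.mono_neutral_right[OF fin])
    show "?A \<union> (*) p ` ?A \<subseteq> {d. d dvd g}"
      using p by (auto intro: divides_mult simp: prime_imp_coprime)
    show "\<forall>d\<in>{d. d dvd g} - (?A \<union> (*) p ` ?A). moebius_mu d = 0"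
    proof
      fix d assume d: "d \<in> {d. d dvd g} - (?A \<union> (*) p ` ?A)"
      then obtain c where c: "d = p * c" by blast
      hence "c dvd g" using d dvd_trans[of c d g] by auto
      hence "p dvd c" using d c by auto
      hence "p ^ 2 dvd d" by (simp add: c power2_eq_square)
      thus "moebius_mu d = 0" by (rule moebius_mu_prime_square[OF p(1)])
    qed
  qed
  also have "\<dots> = (\<Sum>d\<in>?A. moebius_mu d) + (\<Sum>d\<in>(*) p ` ?A. moebius_mu d)"
    using assms by (intro sum.union_disjoint) auto
  also have "(\<Sum>d\<in>(*) p ` ?A. moebius_mu d) = (\<Sum>d\<in>?A. moebius_mu (p * d))"
    using p by (subst sum.reindex) (auto simp: inj_on_def prime_gt_0_nat)
  also have "\<dots> = (\<Sum>d\<in>?A. - moebius_mu d)"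
    using p by (intro sum.cong) (auto simp: moebius_mu_prime_mult)
  finally show ?thesis using False by (simp add: sum_negf)
qed simp

definition moebius_euler :: "nat \<Rightarrow> complex \<Rightarrow> complex" where
  "moebius_euler N q = (\<Prod>d | d dvd N. euler_phi (q ^ d) powi moebius_mu d)"

text \<open>The exponents divisible by \<open>d\<close> are sorted by residue modulo
  \<open>N\<close>. Representatives from 1 to \<open>N\<close> are the smallest positive exponents
  of their classes.\<close>

lemma euler_phi_divisor:
  assumes "norm q < 1" "d dvd N" "N > 0"
  shows "euler_phi (q ^ d) = (\<Prod>a | a \<in> {1..N} \<and> d dvd a. qpoch (q ^ a) (q ^ N))"
proof -
  obtain m where m: "N = d * m" using assms(2) by blast
  have pos: "d > 0" "m > 0" using assms(3) m by auto
  have "euler_phi (q ^ d) = (\<Prod>i<m. qpoch (q ^ d * (q ^ d) ^ i) ((q ^ d) ^ m))"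
    unfolding euler_phi_def using assms(1) pos
    by (intro qpoch_multisection norm_power_less_1)
  also have "\<dots> = (\<Prod>a | a \<in> {1..N} \<and> d dvd a. qpoch (q ^ a) (q ^ N))"
  proof (rule prod.reindex_bij_witness[of _ "\<lambda>a. a div d - 1" "\<lambda>i. d * Suc i"])
    fix i assume i: "i \<in> {..<m}"
    show "d * Suc i div d - 1 = i" using pos by simp
    have "d * Suc i \<le> d * m" using i by (intro mult_le_mono2) auto
    thus "d * Suc i \<in> {a. a \<in> {1..N} \<and> d dvd a}" using pos by (auto simp: m)
    show "qpoch (q ^ (d * Suc i)) (q ^ N) = qpoch (q ^ d * (q ^ d) ^ i) ((q ^ d) ^ m)"
      by (simp add: m power_mult power_add)
  next
    fix a assume a: "a \<in> {a. a \<in> {1..N} \<and> d dvd a}"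
    then obtain c where c: "a = d * c" by blast
    have "c > 0" "c \<le> m" using a c m pos by auto
    thus "d * Suc (a div d - 1) = a" "a div d - 1 \<in> {..<m}" using pos c by auto
  qed
  finally show ?thesis .
qed

text \<open>The class of \<open>a\<close> occurs with exponent \<open>\<Sum> moebius_mu d\<close>
  over the divisors \<open>d\<close> of \<open>gcd a N\<close>, which is 1 if \<open>a\<close> is
  coprime to \<open>N\<close> and 0 otherwise.\<close>

lemma moebius_euler_eq:
  assumes "norm q < 1" "q \<noteq> 0" "N > 0"
  shows "moebius_euler N q = (\<Prod>a\<in>totatives N. qpoch (q ^ a) (q ^ N))"
proof -
  define F where "F = (\<lambda>a. qpoch (q ^ a) (q ^ N))"
  have F: "F a \<noteq> 0" if "a \<in> {1..N}" for a
    unfolding F_def using that assms by (intro qpoch_nonzero' norm_power_less_1) auto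
  have powi_prod: "(\<Prod>a\<in>A. f a) powi k = (\<Prod>a\<in>A. f a powi k)" for A :: "nat set" and f :: "nat \<Rightarrow> complex" and k
    by (induction A rule: infinite_finite_induct) (auto simp: power_int_mult_distrib)
  have "moebius_euler N q = (\<Prod>d | d dvd N. \<Prod>a\<in>{1..N}. if d dvd a then F a powi moebius_mu d else 1)"
    unfolding moebius_euler_def
  proof (intro prod.cong refl)
    fix d assume "d \<in> {d. d dvd N}"
    hence "euler_phi (q ^ d) powi moebius_mu d = (\<Prod>a | a \<in> {1..N} \<and> d dvd a. F a powi moebius_mu d)"
      using euler_phi_divisor[OF assms(1) _ assms(3)] by (simp add: F_def powi_prod)
    also have "\<dots> = (\<Prod>a\<in>{1..N}. if d dvd a then F a powi moebius_mu d else 1)"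
      by (subst prod.inter_filter [symmetric]) auto
    finally show "euler_phi (q ^ d) powi moebius_mu d = (\<Prod>a\<in>{1..N}. if d dvd a then F a powi moebius_mu d else 1)" .
  qed
  also have "\<dots> = (\<Prod>a\<in>{1..N}. \<Prod>d | d dvd N. if d dvd a then F a powi moebius_mu d else 1)"
    by (rule prod.swap)
  also have "\<dots> = (\<Prod>a\<in>{1..N}. if coprime a N then F a else 1)"
  proof (intro prod.cong refl)
    fix a assume a: "a \<in> {1..N}"
    have "(\<Prod>d | d dvd N. if d dvd a then F a powi moebius_mu d else 1) = (\<Prod>d | d dvd gcd a N. F a powi moebius_mu d)"
      using assms(3) by (subst prod.inter_filter [symmetric]) (auto intro!: prod.cong)
    also have "\<dots> = F a powi (\<Sum>d | d dvd gcd a N. moebius_mu d)"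
      using F[OF a] by (rule power_int_sum [symmetric])
    also have "\<dots> = (if coprime a N then F a else 1)"
      using assms(3) by (subst sum_moebius_mu) (auto simp: coprime_iff_gcd_eq_1)
    finally show "(\<Prod>d | d dvd N. if d dvd a then F a powi moebius_mu d else 1) = (if coprime a N then F a else 1)" .
  qed
  also have "\<dots> = (\<Prod>a\<in>{a\<in>{1..N}. coprime a N}. F a)"
    by (rule prod.inter_filter [symmetric]) auto
  also have "{a\<in>{1..N}. coprime a N} = totatives N"
    by (auto simp: in_totatives_iff)
  finally show ?thesis by (simp add: F_def)
qed

lemma moebius_euler_1 [simp]: "moebius_euler (Suc 0) q = euler_phi q"
  by (simp add: moebius_euler_def)

text \<open>The divisors of \<open>p * n\<close> are the \<open>d\<close> and the
  \<open>p * d\<close> with \<open>d\<close> dividing \<open>n\<close>, and the latter carry the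
  opposite sign.\<close>

lemma moebius_euler_prime_mult_coprime:
  assumes "prime p" "\<not> p dvd n" "n > 0"
  shows "moebius_euler (p * n) q = moebius_euler n q / moebius_euler n (q ^ p)"
proof -
  have p0: "p > 0" using assms(1) by (rule prime_gt_0_nat)
  have "{d. d dvd p * n} = {d. d dvd n} \<union> (*) p ` {d. d dvd n}"
  proof (intro equalityI subsetI)
    fix d assume d: "d \<in> {d. d dvd p * n}"
    show "d \<in> {d. d dvd n} \<union> (*) p ` {d. d dvd n}"
    proof (cases "p dvd d")
      case True
      then obtain c where "d = p * c" by blast
      thus ?thesis using d p0 by auto
    next
      case False
      hence "coprime d p" using prime_imp_coprime[OF assms(1)] coprime_commute by blast
      thus ?thesis using d by (simp add: coprime_dvd_mult_right_iff)
    qed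
  qed auto
  moreover have "{d. d dvd n} \<inter> (*) p ` {d. d dvd n} = {}"
    using assms(2) dvd_mult_left by auto
  ultimately have "moebius_euler (p * n) q = moebius_euler n q * (\<Prod>d\<in>(*) p ` {d. d dvd n}. euler_phi (q ^ d) powi moebius_mu d)"
    unfolding moebius_euler_def using assms(3) by (simp add: prod.union_disjoint)
  also have "(\<Prod>d\<in>(*) p ` {d. d dvd n}. euler_phi (q ^ d) powi moebius_mu d) =
      (\<Prod>d | d dvd n. euler_phi (q ^ (p * d)) powi moebius_mu (p * d))"
    using p0 by (subst prod.reindex) (auto simp: inj_on_def)
  also have "\<dots> = (\<Prod>d | d dvd n. inverse (euler_phi ((q ^ p) ^ d) powi moebius_mu d))"
  proof (intro prod.cong refl)
    fix d assume "d \<in> {d. d dvd n}"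
    hence "\<not> p dvd d" using assms(2) dvd_trans by blast
    thus "euler_phi (q ^ (p * d)) powi moebius_mu (p * d) = inverse (euler_phi ((q ^ p) ^ d) powi moebius_mu d)"
      using assms(1) by (simp add: moebius_mu_prime_mult power_mult power_int_minus)
  qed
  also have "\<dots> = inverse (moebius_euler n (q ^ p))"
    using prod_inversef[of "\<lambda>d. euler_phi ((q ^ p) ^ d) powi moebius_mu d" "{d. d dvd n}"]
    by (simp add: moebius_euler_def o_def)
  finally show ?thesis by (simp add: divide_inverse)
qed

text \<open>A divisor of \<open>p * n\<close> that does not divide \<open>n\<close> is a multiple of
  \<open>p ^ 2\<close>, so its exponent is 0.\<close>

lemma moebius_euler_prime_mult_dvd:
  assumes "prime p" "p dvd n" "n > 0"
  shows "moebius_euler (p * n) q = moebius_euler n q"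
  unfolding moebius_euler_def
proof (rule prod.mono_neutral_right)
  show "finite {d. d dvd p * n}" using assms by (simp add: prime_gt_0_nat)
  show "\<forall>d\<in>{d. d dvd p * n} - {d. d dvd n}. euler_phi (q ^ d) powi moebius_mu d = 1"
  proof
    fix d assume d: "d \<in> {d. d dvd p * n} - {d. d dvd n}"
    have "p ^ 2 dvd d"
    proof (rule ccontr)
      assume np: "\<not> p ^ 2 dvd d"
      show False
      proof (cases "p dvd d")
        case True
        then obtain c where c: "d = p * c" by blast
        hence "\<not> p dvd c" using np by (auto simp: power2_eq_square)
        hence "coprime p c" by (rule prime_imp_coprime[OF assms(1)])
        moreover have "c dvd n" using d c assms(1) by (auto simp: prime_gt_0_nat)
        ultimately have "d dvd n" using c assms(2) by (simp add: divides_mult)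
        thus False using d by simp
      next
        case False
        hence "coprime d p" using prime_imp_coprime[OF assms(1)] coprime_commute by blast
        thus False using d by (simp add: coprime_dvd_mult_right_iff)
      qed
    qed
    thus "euler_phi (q ^ d) powi moebius_mu d = 1"
      by (simp add: moebius_mu_prime_square[OF assms(1)])
  qed
qed auto

section \<open>The eta product without its power of \<open>q\<close>, by the factorisation of
  \<open>N\<close>\<close>

definition saito_product :: "nat \<Rightarrow> complex \<Rightarrow> complex" where
  "saito_product N q = euler_phi (q ^ N) ^ totient N / moebius_euler N q"

lemma saito_product_1: "norm q < 1 \<Longrightarrow> saito_product (Suc 0) q = 1"
  by (simp add: saito_product_def euler_phi_nonzero)

lemma saito_product_prime:
  assumes "prime p" "norm q < 1" "q \<noteq> 0"
  shows "saito_product p q = core_sum p q"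
proof -
  have p: "p > 0" "\<not> p dvd Suc 0" using assms(1) by (auto simp: prime_gt_0_nat)
  obtain r where r: "p = Suc r" using p by (cases p) auto
  have "moebius_euler p q = euler_phi q / euler_phi (q ^ p)"
    using moebius_euler_prime_mult_coprime[OF assms(1) p(2), of q] by simp
  thus ?thesis
    using assms p by (simp add: saito_product_def core_sum_eq totient_prime) (simp add: r)
qed

text \<open>The denominator stays the same and the totient is multiplied by \<open>p\<close>. The
  numerator becomes a power of \<open>E(q^(p n))^p = core_sum p (q ^ n) * E(q^n)\<close>.\<close>

lemma saito_product_prime_mult_dvd:
  assumes "prime p" "p dvd n" "n > 0" "norm q < 1" "q \<noteq> 0"
  shows "saito_product (p * n) q = core_sum p (q ^ n) ^ totient n * saito_product n q"
proof -
  have p: "p > 0" using assms(1) by (rule prime_gt_0_nat)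
  have "gcd p n = p" using assms(2) by (simp add: gcd_nat.absorb1)
  hence tot: "totient (p * n) = p * totient n"
    using p by (simp add: totient_mult mult.assoc)
  have pw: "(q ^ n) ^ p = q ^ (p * n)" by (simp add: power_mult [symmetric] mult.commute)
  have qn: "norm (q ^ n) < 1" "q ^ n \<noteq> 0" using power_pos_less_1 assms by auto
  show ?thesis
    using moebius_euler_prime_mult_dvd[OF assms(1-3), of q] euler_phi_nonzero[OF qn(1)]
    by (simp add: saito_product_def tot core_sum_eq[OF qn p] pw power_divide power_mult)
qed

text \<open>The involution taking \<open>a\<close> to \<open>n - a\<close> has no fixed point:
  \<open>2 * a = n\<close> with \<open>a\<close> coprime to \<open>n\<close> would force
  \<open>a = 1\<close> and \<open>n = 2\<close>.\<close>

lemma prod_totatives_pair: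
  fixes f :: "nat \<Rightarrow> 'a :: comm_monoid_mult"
  assumes "n \<ge> 3"
  shows "(\<Prod>a\<in>totatives n. f a) = (\<Prod>a | a \<in> totatives n \<and> 2 * a < n. f a * f (n - a))"
    "totient n = 2 * card {a \<in> totatives n. 2 * a < n}"
proof -
  let ?H = "{a \<in> totatives n. 2 * a < n}"
  have cop: "coprime (n - a) n" if "coprime a n" "a \<le> n" for a
  proof -
    have "gcd (n - a) a = 1"
      using that by (simp only: gcd_diff1_nat gcd.commute[of n a] coprime_iff_gcd_eq_1)
    hence "gcd (n - a) (n - a + a) = 1"
      by (simp only: gcd_add2)
    thus ?thesis using that by (simp add: coprime_iff_gcd_eq_1 gcd.commute)
  qed
  have not_half: "2 * a \<noteq> n" if "coprime a n" for a
  proof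
    assume "2 * a = n"
    hence "a dvd n" by auto
    hence "a = 1" using that by (metis coprime_absorb_left nat_dvd_1_iff_1)
    thus False using \<open>2 * a = n\<close> assms by simp
  qed
  have lt: "a < n" if "a \<in> totatives n" for a
    using totatives_less[OF that] assms by simp
  have inj: "inj_on (\<lambda>a. n - a) ?H"
    using lt by (auto simp: inj_on_def)
  have union: "totatives n = ?H \<union> (\<lambda>a. n - a) ` ?H"
  proof (intro equalityI subsetI)
    fix a assume a: "a \<in> totatives n"
    show "a \<in> ?H \<union> (\<lambda>a. n - a) ` ?H"
    proof (cases "2 * a < n")
      case False
      hence "n - a \<in> ?H" "a = n - (n - a)"
        using a lt[OF a] not_half[of a] cop[of a] by (auto simp: in_totatives_iff)
      thus ?thesis by blast
    qed (use a in auto)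
  next
    fix a assume "a \<in> ?H \<union> (\<lambda>a. n - a) ` ?H"
    thus "a \<in> totatives n" using lt cop by (auto simp: in_totatives_iff)
  qed
  have disj: "?H \<inter> (\<lambda>a. n - a) ` ?H = {}" by auto
  have fin: "finite ?H" by simp
  have "(\<Prod>a\<in>totatives n. f a) = (\<Prod>a\<in>?H. f a) * (\<Prod>a\<in>(\<lambda>a. n - a) ` ?H. f a)"
    by (subst union, rule prod.union_disjoint) (use disj fin in auto)
  also have "(\<Prod>a\<in>(\<lambda>a. n - a) ` ?H. f a) = (\<Prod>a\<in>?H. f (n - a))"
    using inj by (subst prod.reindex) auto
  finally show "(\<Prod>a\<in>totatives n. f a) = (\<Prod>a\<in>?H. f a * f (n - a))"
    by (simp add: prod.distrib)
  have "totient n = card (?H \<union> (\<lambda>a. n - a) ` ?H)"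
    unfolding totient_def by (subst union) simp
  also have "\<dots> = card ?H + card ((\<lambda>a. n - a) ` ?H)"
    using disj fin by (intro card_Un_disjoint) auto
  also have "card ((\<lambda>a. n - a) ` ?H) = card ?H"
    using inj by (rule card_image)
  finally show "totient n = 2 * card ?H" by simp
qed

lemma moebius_euler_theta_prod:
  assumes "norm q < 1" "q \<noteq> 0" "n \<ge> 3"
  shows "moebius_euler n q = (\<Prod>a | a \<in> totatives n \<and> 2 * a < n. theta_prod (q ^ a) (q ^ n))"
proof -
  have "moebius_euler n q = (\<Prod>a\<in>totatives n. qpoch (q ^ a) (q ^ n))"
    using assms by (intro moebius_euler_eq) auto
  also have "\<dots> = (\<Prod>a | a \<in> totatives n \<and> 2 * a < n. qpoch (q ^ a) (q ^ n) * qpoch (q ^ (n - a)) (q ^ n))"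
    by (rule prod_totatives_pair[OF assms(3)])
  also have "\<dots> = (\<Prod>a | a \<in> totatives n \<and> 2 * a < n. theta_prod (q ^ a) (q ^ n))"
    unfolding theta_prod_def using assms by (intro prod.cong) (auto simp: power_diff totatives_le)
  finally show ?thesis .
qed

text \<open>As \<open>totient (p * n)\<close> is \<open>(p - 1) * 2 * card ?H\<close>, each pair
  receives \<open>E'^(2p-2)\<close> and the quotient \<open>[z^p;Q^p] / [z;Q]\<close> at
  \<open>z = q ^ a\<close>. By \<open>marked_core_sum_identity\<close> this is
  \<open>A(z) * E'^(2p) / (core_sum p Q * E^2)\<close>, and \<open>core_sum p Q = E'^p / E\<close>
  simplifies it.\<close>

lemma saito_product_prime_mult_coprime:
  assumes "prime p" "\<not> p dvd n" "n \<ge> 3" "norm q < 1" "q \<noteq> 0"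
  shows "saito_product (p * n) q =
    (\<Prod>a | a \<in> totatives n \<and> 2 * a < n. marked_core_sum p (q ^ a) (q ^ n) * core_sum p (q ^ n))"
proof -
  let ?H = "{a. a \<in> totatives n \<and> 2 * a < n}"
  have p: "p > 0" "p > 1" using assms(1) by (auto simp: prime_gt_0_nat prime_gt_Suc_0_nat)
  have cop: "coprime p n" using assms(1,2) by (rule prime_imp_coprime)
  define Q where "Q = q ^ n"
  have Q: "norm Q < 1" "Q \<noteq> 0" using power_pos_less_1 assms unfolding Q_def by auto
  have Qp: "norm (Q ^ p) < 1" "Q ^ p \<noteq> 0" using power_pos_less_1 Q p by auto
  have qp: "norm (q ^ p) < 1" "q ^ p \<noteq> 0" using power_pos_less_1 assms p by auto
  define E where "E = euler_phi Q"
  define E' where "E' = euler_phi (Q ^ p)"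
  have E: "E \<noteq> 0" "E' \<noteq> 0" using euler_phi_nonzero Q Qp by (auto simp: E_def E'_def)
  have swap: "(q ^ p) ^ n = Q ^ p" "q ^ (p * n) = Q ^ p"
    by (simp_all add: Q_def power_mult [symmetric] mult.commute)
  have "saito_product (p * n) q = E' ^ ((p - 1) * (2 * card ?H)) * (moebius_euler n (q ^ p) / moebius_euler n q)"
    using moebius_euler_prime_mult_coprime[OF assms(1,2), of q] assms(3) cop
    by (simp add: saito_product_def totient_mult_coprime totient_prime[OF assms(1)] swap E'_def
        prod_totatives_pair(2)[OF assms(3)])
  also have "moebius_euler n (q ^ p) = (\<Prod>a\<in>?H. theta_prod ((q ^ a) ^ p) (Q ^ p))"
    unfolding moebius_euler_theta_prod[OF qp assms(3)] swap
    by (simp add: power_mult [symmetric] mult.commute)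
  also have "moebius_euler n q = (\<Prod>a\<in>?H. theta_prod (q ^ a) Q)"
    unfolding moebius_euler_theta_prod[OF assms(4,5,3)] Q_def ..
  also have "E' ^ ((p - 1) * (2 * card ?H)) = (\<Prod>a\<in>?H. E' ^ (2 * (p - 1)))"
    by (simp add: power_mult [symmetric] mult_ac)
  also have "(\<Prod>a\<in>?H. E' ^ (2 * (p - 1))) * ((\<Prod>a\<in>?H. theta_prod ((q ^ a) ^ p) (Q ^ p)) / (\<Prod>a\<in>?H. theta_prod (q ^ a) Q)) =
      (\<Prod>a\<in>?H. E' ^ (2 * (p - 1)) * (theta_prod ((q ^ a) ^ p) (Q ^ p) / theta_prod (q ^ a) Q))"
    by (simp only: prod.distrib prod_dividef)
  also have "\<dots> = (\<Prod>a\<in>?H. marked_core_sum p (q ^ a) (q ^ n) * core_sum p (q ^ n))"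
  proof (intro prod.cong refl)
    fix a assume a: "a \<in> ?H"
    hence a': "0 < a" "a < n" by (auto simp: in_totatives_iff)
    define M where "M = marked_core_sum p (q ^ a) Q"
    define t where "t = theta_prod (q ^ a) Q"
    define t' where "t' = theta_prod ((q ^ a) ^ p) (Q ^ p)"
    have t: "t \<noteq> 0" unfolding t_def Q_def using assms a' by (intro theta_prod_neq_0)
    have core: "core_sum p Q = E' ^ p / E" unfolding E_def E'_def using Q p by (intro core_sum_eq)
    have "M * t * E' ^ 2 = core_sum p Q * E ^ 2 * t'"
      unfolding M_def t_def t'_def E_def E'_def
      using Q p assms by (intro marked_core_sum_identity) auto
    also have "\<dots> = E' ^ p * E * t'" using E by (simp add: core power2_eq_square)
    finally have t': "t' = M * t * E' ^ 2 / (E' ^ p * E)" using E by (simp add: field_simps)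
    have "p + p = 2 * (p - 1) + 2" using p by simp
    hence pp: "E' ^ p * E' ^ p = E' ^ (2 * (p - 1)) * E' ^ 2"
      by (simp only: power_add [symmetric])
    have "E' ^ (2 * (p - 1)) * (t' / t) = M * (E' ^ (2 * (p - 1)) * E' ^ 2) / (E' ^ p * E)"
      using t by (simp add: t')
    also have "\<dots> = M * core_sum p Q"
      unfolding pp [symmetric] core using E by simp
    finally show "E' ^ (2 * (p - 1)) * (theta_prod ((q ^ a) ^ p) (Q ^ p) / theta_prod (q ^ a) Q) =
        marked_core_sum p (q ^ a) (q ^ n) * core_sum p (q ^ n)"
      by (simp add: M_def t_def t'_def Q_def)
  qed
  finally show ?thesis .
qed

lemma nonneg_saito_product_prime_mult_coprime:
  assumes "prime p" "\<not> p dvd n" "n \<ge> 3"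
  shows "nonneg_power_series (saito_product (p * n))"
proof (rule nonneg_power_series_cong)
  show "nonneg_power_series (\<lambda>q. \<Prod>a | a \<in> totatives n \<and> 2 * a < n. marked_core_sum p (q ^ a) (q ^ n) * core_sum p (q ^ n))"
    using assms by (intro nonneg_power_series_prod nonneg_power_series_mult nonneg_marked_core_sum nonneg_core_sum)
      (auto simp: prime_gt_0_nat)
  fix q :: complex assume "q \<noteq> 0" "norm q < 1"
  thus "(\<Prod>a | a \<in> totatives n \<and> 2 * a < n. marked_core_sum p (q ^ a) (q ^ n) * core_sum p (q ^ n)) = saito_product (p * n) q"
    using saito_product_prime_mult_coprime[OF assms] by simp
qed

text \<open>A prime is split off from \<open>N\<close>. Only when it still divides the cofactor is
  the induction hypothesis used; the other cases are explicit products.\<close>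

theorem nonneg_saito_product:
  assumes "N > 0"
  shows "nonneg_power_series (saito_product N)"
  using assms
proof (induction N rule: less_induct)
  case (less N)
  show ?case
  proof (cases "N = 1")
    case True
    show ?thesis
      by (rule nonneg_power_series_cong[OF nonneg_power_series_1]) (simp add: True saito_product_1)
  next
    case False
    then obtain p where p: "prime p" "p dvd N" using prime_factor_nat by blast
    then obtain n where n: "N = p * n" by blast
    have n0: "n > 0" using less.prems n by (cases n) auto
    have p1: "p > 1" "p > 0" using p by (auto simp: prime_gt_Suc_0_nat prime_gt_0_nat)
    consider "p dvd n" | "n = 1" | "\<not> p dvd n" "n = 2" | "\<not> p dvd n" "n \<ge> 3"
      using n0 by linarith
    thus ?thesis
    proof cases
      case 1
      have IH: "nonneg_power_series (saito_product n)"
        using n0 p1 n by (intro less.IH) auto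
      show ?thesis
      proof (rule nonneg_power_series_cong)
        show "nonneg_power_series (\<lambda>q. core_sum p (q ^ n) ^ totient n * saito_product n q)"
          using p1 n0 by (intro nonneg_power_series_mult nonneg_power_series_power nonneg_core_sum IH)
      qed (simp add: n saito_product_prime_mult_dvd[OF p(1) 1 n0])
    next
      case 2
      show ?thesis
      proof (rule nonneg_power_series_cong)
        show "nonneg_power_series (\<lambda>q. core_sum p (q ^ 1))"
          using p1 by (intro nonneg_core_sum) auto
      qed (simp add: n 2 saito_product_prime[OF p(1)])
    next
      \<comment> \<open>The pairing requires a cofactor of at least 3, so the roles are exchanged:
        the prime is 2 and the cofactor is the odd \<open>p\<close>.\<close>
      case 3
      hence p2: "p \<noteq> 2" by auto
      hence "p \<ge> 3" using p1 by linarith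
      moreover have "\<not> 2 dvd p"
        using primes_dvd_imp_eq[OF two_is_prime_nat p(1)] p2 by blast
      ultimately show ?thesis
        using nonneg_saito_product_prime_mult_coprime[OF two_is_prime_nat, of p] 3
        by (simp add: n mult.commute)
    next
      case 4
      thus ?thesis unfolding n by (intro nonneg_saito_product_prime_mult_coprime p)
    qed
  qed
qed

section \<open>Expansions in powers of \<open>q\<close>\<close>

lemma q_pow_add: "q_pow (a + b) \<tau> = q_pow a \<tau> * q_pow b \<tau>"
  by (simp add: q_pow_def of_rat_add algebra_simps exp_add)

lemma q_pow_power: "q_pow a \<tau> ^ n = q_pow (of_nat n * a) \<tau>"
  by (simp add: q_pow_def of_rat_mult exp_of_nat_mult [symmetric] mult_ac)

lemma q_pow_powi: "q_pow a \<tau> powi k = q_pow (of_int k * a) \<tau>"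
  by (simp add: q_pow_def of_rat_mult exp_power_int mult_ac)

lemma q_pow_scale: "q_pow a (of_nat n * \<tau>) = q_pow (of_nat n * a) \<tau>"
  by (simp add: q_pow_def of_rat_mult mult_ac)

lemma q_pow_0 [simp]: "q_pow 0 \<tau> = 1"
  by (simp add: q_pow_def)

lemma q_pow_sum: "q_pow (\<Sum>i\<in>I. f i) \<tau> = (\<Prod>i\<in>I. q_pow (f i) \<tau>)"
  by (induction I rule: infinite_finite_induct) (auto simp: q_pow_add)

lemma q_pow_nonzero [simp]: "q_pow a \<tau> \<noteq> 0"
  by (simp add: q_pow_def)

lemma norm_q_pow_1: "Im \<tau> > 0 \<Longrightarrow> norm (q_pow 1 \<tau>) < 1"
  by (simp add: q_pow_def)

text \<open>This carries identities on the upper half-plane over to the punctured disc, where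
  coefficients can be compared.\<close>

lemma q_pow_1_surj:
  assumes "q \<noteq> 0" "norm q < 1"
  obtains \<tau> where "Im \<tau> > 0" "q_pow 1 \<tau> = q"
proof
  define \<tau> where "\<tau> = Ln q / (2 * of_real pi * \<i>)"
  show "q_pow 1 \<tau> = q"
    using assms by (simp add: q_pow_def \<tau>_def)
  have "\<tau> = of_real (1 / (2 * pi)) * (- \<i> * Ln q)"
    by (simp add: \<tau>_def field_simps)
  hence "Im \<tau> = 1 / (2 * pi) * (- ln (norm q))"
    using assms by simp
  thus "Im \<tau> > 0"
    using assms by (simp add: divide_neg_pos)
qed

lemma dedekind_eta_scale: "dedekind_eta (of_nat d * \<tau>) = q_pow (of_nat d / 24) \<tau> * euler_phi (q_pow 1 \<tau> ^ d)"
  by (simp add: dedekind_eta_def q_pow_scale euler_phi_def qpoch_def q_pow_power)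

lemma eta_S_eq_saito_product:
  "\<exists>s. \<forall>\<tau>. eta_S N \<tau> = q_pow s \<tau> * saito_product N (q_pow 1 \<tau>)"
proof (intro exI allI)
  fix \<tau>
  let ?e = "of_nat (totient N) * (of_nat N / 24) :: rat"
  let ?t = "\<Sum>d | d dvd N. of_int (moebius_mu d) * (of_nat d / 24) :: rat"
  have "(\<Prod>d | d dvd N. dedekind_eta (of_nat d * \<tau>) powi moebius_mu d) = q_pow ?t \<tau> * moebius_euler N (q_pow 1 \<tau>)"
    by (simp add: dedekind_eta_scale power_int_mult_distrib q_pow_powi prod.distrib q_pow_sum moebius_euler_def)
  moreover have "dedekind_eta (of_nat N * \<tau>) ^ totient N = q_pow ?e \<tau> * euler_phi (q_pow 1 \<tau> ^ N) ^ totient N"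
    by (simp add: dedekind_eta_scale power_mult_distrib q_pow_power)
  moreover have "q_pow (?e - ?t) \<tau> * q_pow ?t \<tau> = q_pow ?e \<tau>"
    by (simp add: q_pow_add [symmetric])
  hence "q_pow (?e - ?t) \<tau> = q_pow ?e \<tau> / q_pow ?t \<tau>"
    by (simp add: field_simps)
  ultimately show "eta_S N \<tau> = q_pow (?e - ?t) \<tau> * saito_product N (q_pow 1 \<tau>)"
    by (simp add: eta_S_def saito_product_def)
qed

section \<open>Comparison of two expansions of the same function\<close>

lemma power_series_zero_coeff:
  fixes c :: "nat \<Rightarrow> complex"
  assumes "\<And>q. q \<noteq> 0 \<Longrightarrow> norm q < 1 \<Longrightarrow> (\<lambda>n. c n * q ^ n) sums 0"
  shows "c n = 0"
proof (induction n rule: less_induct)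
  case (less n)
  have "(\<lambda>j. c (j + n) * q ^ j) sums 0" if q: "q \<noteq> 0" "norm q < 1" for q :: complex
  proof -
    have "(\<lambda>j. c (j + n) * q ^ (j + n)) sums (0 - (\<Sum>i<n. c i * q ^ i))"
      using assms[OF q] by (subst sums_iff_shift) simp
    also have "(\<Sum>i<n. c i * q ^ i) = 0"
      using less by simp
    finally have "(\<lambda>j. c (j + n) * q ^ (j + n) / q ^ n) sums ((0 - 0) / q ^ n)"
      by (rule sums_divide)
    thus ?thesis using q by (simp add: power_add)
  qed
  \<comment> \<open>The identity holds only on the punctured disc, so \<open>c n\<close> is obtained
    as the limit for \<open>q\<close> to 0.\<close>
  hence "((\<lambda>_. 0) \<longlongrightarrow> c (0 + n)) (at (0 :: complex))"
    by (intro powser_limit_0_strong[of 1 "\<lambda>j. c (j + n)"]) auto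
  thus ?case by (simp add: tendsto_const_iff)
qed

lemma has_q_expansion_sums:
  assumes "has_q_expansion f s a" "Im \<tau> > 0"
  shows "(\<lambda>n. of_int (a n) * q_pow 1 \<tau> ^ n) sums (f \<tau> / q_pow s \<tau>)"
proof -
  have "(\<lambda>n. of_int (a n) * q_pow (s + of_nat n) \<tau> / q_pow s \<tau>) sums (f \<tau> / q_pow s \<tau>)"
    using assms by (intro sums_divide) (auto simp: has_q_expansion_def)
  thus ?thesis by (simp add: q_pow_add q_pow_power)
qed

text \<open>This determines \<open>s\<close> modulo 1 unless \<open>f\<close> vanishes.\<close>
lemma has_q_expansion_translate:
  assumes "has_q_expansion f s a" "Im \<tau> > 0"
  shows "f (\<tau> + 1) = exp (2 * of_real pi * \<i> * of_rat s) * f \<tau>"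
proof -
  have "q_pow 1 (\<tau> + 1) = q_pow 1 \<tau>"
    by (simp add: q_pow_def distrib_left exp_add)
  hence "f (\<tau> + 1) / q_pow s (\<tau> + 1) = f \<tau> / q_pow s \<tau>"
    using has_q_expansion_sums[OF assms] has_q_expansion_sums[OF assms(1), of "\<tau> + 1"] assms(2)
    by (auto intro: sums_unique2)
  moreover have "q_pow s (\<tau> + 1) = exp (2 * of_real pi * \<i> * of_rat s) * q_pow s \<tau>"
    by (simp add: q_pow_def distrib_left exp_add mult_ac)
  ultimately show ?thesis by (simp add: field_simps)
qed

lemma has_q_expansion_shift:
  assumes "has_q_expansion f s a" "has_q_expansion f (s + of_nat k) b"
  shows "b n = a (n + k)" and "n < k \<Longrightarrow> a n = 0"
proof -
  \<comment> \<open>The difference of both coefficient sequences once \<open>b\<close> is padded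
    with \<open>k\<close> zeros to start at the exponent \<open>s\<close>.\<close>
  define c where "c = (\<lambda>n. a n - (if n < k then 0 else b (n - k)))"
  have "(\<lambda>n. of_int (c n) * q ^ n) sums 0" if q: "q \<noteq> 0" "norm q < 1" for q :: complex
  proof -
    obtain \<tau> where \<tau>: "Im \<tau> > 0" "q_pow 1 \<tau> = q" using q_pow_1_surj[OF q] .
    have "(\<lambda>n. of_int (b n) * q ^ n * q ^ k) sums (f \<tau> / q_pow (s + of_nat k) \<tau> * q ^ k)"
      using has_q_expansion_sums[OF assms(2) \<tau>(1)] \<tau>(2) by (intro sums_mult2) simp
    also have "f \<tau> / q_pow (s + of_nat k) \<tau> * q ^ k = f \<tau> / q_pow s \<tau>"
      using q \<tau>(2) [symmetric] by (simp add: q_pow_add q_pow_power)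
    also have "(\<lambda>n. of_int (b n) * q ^ n * q ^ k) = (\<lambda>n. (\<lambda>n. of_int (if n < k then 0 else b (n - k)) * q ^ n) (n + k))"
      by (simp add: power_add mult_ac)
    finally have "(\<lambda>n. of_int (if n < k then 0 else b (n - k)) * q ^ n) sums (f \<tau> / q_pow s \<tau>)"
      by (subst (asm) sums_iff_shift) (simp del: of_int_eq_0_iff)
    from sums_diff[OF has_q_expansion_sums[OF assms(1) \<tau>(1), unfolded \<tau>(2)] this] show ?thesis
      by (simp add: c_def algebra_simps)
  qed
  hence c: "c n = 0" for n
    using power_series_zero_coeff[of "\<lambda>n. of_int (c n)" n] by simp
  show "b n = a (n + k)" using c[of "n + k"] by (simp add: c_def)
  show "a n = 0" if "n < k" using c[of n] that by (simp add: c_def)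
qed

lemma has_q_expansion_zero:
  assumes "has_q_expansion f s a" "\<And>\<tau>. Im \<tau> > 0 \<Longrightarrow> f \<tau> = 0"
  shows "a n = 0"
proof -
  have "(\<lambda>n. of_int (a n) * q ^ n) sums 0" if q: "q \<noteq> 0" "norm q < 1" for q :: complex
  proof -
    obtain \<tau> where "Im \<tau> > 0" "q_pow 1 \<tau> = q" using q_pow_1_surj[OF q] .
    thus ?thesis using has_q_expansion_sums[OF assms(1), of \<tau>] assms(2)[of \<tau>] by simp
  qed
  thus ?thesis
    using power_series_zero_coeff[of "\<lambda>n. of_int (a n)" n] by simp
qed

lemma complex_of_rat_eq_of_real: "complex_of_rat x = complex_of_real (real_of_rat x)"
  by (cases x) (simp add: of_rat_rat)

text \<open>If \<open>f\<close> is not zero, translation by 1 shows that \<open>s - s'\<close> is an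
  integer, so the two coefficient sequences agree up to shifting and padding with zeros. If
  \<open>f\<close> is zero, all coefficients vanish.\<close>

lemma has_q_expansion_nonneg:
  assumes a: "has_q_expansion f s a" and b: "has_q_expansion f s' b" and "\<And>n. b n \<ge> 0"
  shows "a n \<ge> 0"
proof (cases "\<forall>\<tau>. Im \<tau> > 0 \<longrightarrow> f \<tau> = 0")
  case True
  thus ?thesis using has_q_expansion_zero[OF a] by simp
next
  case False
  then obtain \<tau> where \<tau>: "Im \<tau> > 0" "f \<tau> \<noteq> 0" by blast
  have "exp (2 * of_real pi * \<i> * of_rat s) = exp (2 * of_real pi * \<i> * of_rat s')"
    using has_q_expansion_translate[OF a \<tau>(1)] has_q_expansion_translate[OF b \<tau>(1)] \<tau>(2) by simp
  hence "exp (2 * of_real pi * \<i> * of_rat (s - s')) = 1"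
    by (simp add: of_rat_diff right_diff_distrib exp_diff)
  moreover have "2 * of_real pi * \<i> * of_rat (s - s') = complex_of_real (2 * pi * of_rat (s - s')) * \<i>"
    by (simp add: complex_of_rat_eq_of_real)
  ultimately obtain k :: int where k: "2 * pi * of_rat (s - s') = of_int (2 * k) * pi"
    by (auto simp: exp_eq_1)
  hence "(of_rat (s - s') :: real) = of_rat (of_int k)" by simp
  hence k: "s - s' = of_int k" by (simp only: of_rat_eq_iff)
  show ?thesis
  proof (cases "k \<ge> 0")
    case True
    hence "s = s' + of_nat (nat k)" using k by (simp add: algebra_simps)
    thus ?thesis using has_q_expansion_shift(1)[OF b, of "nat k" a n] a assms(3) by simp
  next
    case False
    hence s': "s' = s + of_nat (nat (- k))" using k by (simp add: algebra_simps)
    note b = b[unfolded s']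
    show ?thesis
    proof (cases "n < nat (- k)")
      case True
      thus ?thesis using has_q_expansion_shift(2)[OF a b] by simp
    next
      case False
      thus ?thesis using has_q_expansion_shift(1)[OF a b, of "n - nat (- k)"] assms(3)[of "n - nat (- k)"] by simp
    qed
  qed
qed

theorem mainTheorem1:
  fixes N :: nat
  assumes "N > 0"
  shows "(\<exists>s a. has_q_expansion (eta_S N) s a) \<and>
         (\<forall>s a. has_q_expansion (eta_S N) s a \<longrightarrow> (\<forall>n. a n \<ge> 0))"
proof -
  obtain s where s: "\<And>\<tau>. eta_S N \<tau> = q_pow s \<tau> * saito_product N (q_pow 1 \<tau>)"
    using eta_S_eq_saito_product[of N] by blast
  obtain b :: "nat \<Rightarrow> nat" where b: "\<And>q. q \<noteq> 0 \<Longrightarrow> norm q < 1 \<Longrightarrow> (\<lambda>n. of_nat (b n) * q ^ n) sums saito_product N q"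
    using nonneg_saito_product[OF assms] by (auto simp: nonneg_power_series_def)
  have "has_q_expansion (eta_S N) s (\<lambda>n. int (b n))"
    unfolding has_q_expansion_def
  proof (intro allI impI)
    fix \<tau> assume "Im \<tau> > 0"
    hence "(\<lambda>n. q_pow s \<tau> * (of_nat (b n) * q_pow 1 \<tau> ^ n)) sums eta_S N \<tau>"
      unfolding s by (intro sums_mult b norm_q_pow_1) auto
    thus "(\<lambda>n. of_int (int (b n)) * q_pow (s + of_nat n) \<tau>) sums eta_S N \<tau>"
      by (simp add: q_pow_add q_pow_power mult_ac)
  qed
  \<comment> \<open>One expansion with nonnegative coefficients settles all the others.\<close>
  thus ?thesis using has_q_expansion_nonneg by (meson of_nat_0_le_iff)
qed

end
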